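(* Let $\mathcal A$ be an associative algebra with identity and trace map, let $\iota\in\mathbb C$, and let $\mathcal M$ be a $\check{\mathcal A}$-module generated by a subspace $\mathcal M_0$ such that $\check{\mathcal A}^m(\mathcal M_0)=\{0\}$ for some $m\in\mathbb N$. Then on $\mathcal M$, $$[Y^\iota_{\mathcal M}(u,z_1),Y^\iota_{\mathcal M}(v,z_2)]=\mathrm{Res}_{z_0}\,z_1^{-1}\delta\!\left(\frac{z_2+z_0}{z_1}\right)Y^\iota_{\mathcal M}(Y^+(u,z_0)v,z_2)$$ for all $u,v\in\hat R(\mathcal A)$. In particular, $\mathcal M$ provides a representation $\sigma^\iota_{\mathcal M}$ of the Lie algebra $\hat{\mathcal A}$ given by $\sigma^\iota_{\mathcal M}(\kappa)=\kappa_0$ and $$\sigma^\iota_{\mathcal M}(a\otimes t^m\partial_t^r)=\sum_{l\in\mathcal Z}\langle-l+\iota-1/2\rangle_r\,a(m-r-l,l)+r!\,\delta_{r,m}\,\Im_{0,r}\,(\mathrm{tr}\,a)\,\kappa_0$$ for $m\in\mathbb Z$, $r\in\mathbb N$, $a\in\mathcal A$.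
   Context: All spaces are over $\mathbb C$; $\mathbb N$ = nonnegative integers; $\mathcal Z=\mathbb Z+1/2$; $\langle\mu\rangle_0=1$, $\langle\mu\rangle_m=\mu(\mu-1)\cdots(\mu-m+1)$. $\mathrm{Res}_z$ extracts the coefficient of $z^{-1}$; $\delta(z)=\sum_{k\in\mathbb Z}z^k$; binomials are expanded in nonnegative powers of the second variable. $\mathcal A$ is an associative algebra with identity $1_{\mathcal A}$ and a linear map $\mathrm{tr}:\mathcal A\to\mathbb C$ with $\mathrm{tr}\,1_{\mathcal A}\ne0$ and $\mathrm{tr}\,ab=\mathrm{tr}\,ba$. $\mathbb A=\sum_{i\ge0}\mathbb C[t,t^{-1}]\partial_t^i$ is the algebra of differential operators, $\partial_t=d/dt$. $\hat{\mathcal A}=\mathcal A\otimes\mathbb A\oplus\mathbb C\kappa$ is the Lie algebra with $\kappa$ central and $$[a\otimes t^{i_1}\partial_t^{j_1},b\otimes t^{i_2}\partial_t^{j_2}]=ab\otimes t^{i_1}\partial_t^{j_1}\cdot t^{i_2}\partial_t^{j_2}-ba\otimes t^{i_2}\partial_t^{j_2}\cdot t^{i_1}\partial_t^{j_1}+(-1)^{j_1}\delta_{i_1+i_2,j_1+j_2}j_1!j_2!\binom{i_1}{j_1+j_2+1}(\mathrm{tr}\,ab)\kappa.$$ $\check{\mathcal A}=\bigoplus_{i,j\in\mathcal Z}\mathcal A t_1^it_2^j\oplus\mathbb C\kappa_0$, with $a(i,j)=at_1^it_2^j$, is the Lie algebra with $\kappa_0$ central and $$[a(l_1,l_2),b(k_1,k_2)]=\delta_{l_2+k_1,0}\,ab(l_1,k_2)-\delta_{l_1+k_2,0}\,ba(k_1,l_2)+\delta_{l_1+k_2,0}\delta_{l_2+k_1,0}[H(l_1)H(l_2)-H(k_1)H(k_2)](\mathrm{tr}\,ab)\kappa_0,$$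 where $H(l)=1$ for $l>0$ and $0$ for $l<0$. $\check{\mathcal A}^m=\mathrm{Span}\{a(i,j)\mid a\in\mathcal A,\ i,j\in\mathcal Z,\ |i|,|j|>m,\ ij<0\}$. $\hat R(\mathcal A)=\mathcal A[\varsigma_1,\varsigma_2]\oplus\mathbb C\mathbf 1$ with $a[m_1,m_2]=a\varsigma_1^{m_1}\varsigma_2^{m_2}$ is a conformal algebra with linear map $Y^+(\cdot,z)$ given by $Y^+(w,z)\mathbf 1=Y^+(\mathbf 1,z)w=0$ and $$Y^+(a[m_1,m_2],z)b[n_1,n_2]=\binom{-n_1-1}{m_2}\sum_{p=0}^{m_1+m_2+n_1}\binom p{m_1}ab[p,n_2]z^{p-m_1-m_2-n_1-1}-\binom{-n_2-1}{m_1}\sum_{q=0}^{m_1+m_2+n_2}\binom q{m_2}ba[n_1,q]z^{q-m_1-m_2-n_2-1}$$ $$+\binom{-n_1-1}{m_2}\binom{-n_2-1}{m_1}(\mathrm{tr}\,ab)\mathbf 1\,z^{-m_1-m_2-n_1-n_2-2}.$$ The constants $\Im_{r_1,r_2}$ are defined by $$\sum_{r_1,r_2\ge0}\Im_{r_1,r_2}x^{r_1}y^{r_2}z^{-r_1-r_2-1}=\frac1{x-y}\left(\Bigl(\frac{z+y}{z+x}\Bigr)^\iota-1\right),$$ expanded in nonnegative powers of $x,y$. The linear map $Y^\iota_{\mathcal M}(\cdot,z)$ from $\hat R(\mathcal A)$ to linear maps $\mathcal M\to\mathcal M[[z^{-1},z]]$ is defined by $Y^\iota_{\mathcal M}(\mathbf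 1,z)=\kappa_0$ and $$Y^\iota_{\mathcal M}(a[r_1,r_2],z)=\sum_{i,j\in\mathcal Z}\binom{-i-\iota-1/2}{r_1}\binom{-j+\iota-1/2}{r_2}a(i,j)z^{-i-j-r_1-r_2-1}+\Im_{r_1,r_2}(\mathrm{tr}\,a)\kappa_0z^{-r_1-r_2-1}.$$ *)

theory Defs
  imports Complex_Main
    "HOL-Library.Poly_Mapping"
    "HOL-Library.Product_Plus"
    "HOL-Computational_Algebra.Formal_Laurent_Series"
begin

section \<open>The coefficient algebra and one-dimensional central extensions\<close>

locale trace_algebra = vector_space sA
  for sA :: "complex \<Rightarrow> 'a::ring_1 \<Rightarrow> 'a" +
  fixes tr :: "'a \<Rightarrow> complex"
  assumes scale_mult_left: "sA c a * b = sA c (a * b)"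
    and scale_mult_right: "a * sA c b = sA c (a * b)"
    and tr_linear: "Vector_Spaces.linear sA (*) tr"
    and tr_one: "tr 1 \<noteq> 0"
    and tr_commute: "tr (a * b) = tr (b * a)"

text \<open>
  The three spaces in play are all of the form \<open>(\<Oplus>\<^sub>k A e\<^sub>k) \<oplus> \<complex>\<close>, with \<open>k\<close> ranging over a type of
  indices; the second component is the coefficient of the central element
  (\<open>\<kappa>\<close>, \<open>\<kappa>\<^sub>0\<close> and the vector \<open>1\<close>, respectively).
\<close>

type_synonym ('k, 'a) cext = "('k \<Rightarrow>\<^sub>0 'a) \<times> complex"

definition cext_scale :: "(complex \<Rightarrow> 'a \<Rightarrow> 'a) \<Rightarrow> complex \<Rightarrow> ('k, 'a::zero) cext \<Rightarrow> ('k, 'a) cext"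
  where "cext_scale sA c X = (Poly_Mapping.map (sA c) (fst X), c * snd X)"

definition elt :: "'a \<Rightarrow> 'k \<Rightarrow> ('k, 'a::zero) cext"
  where "elt a k = (Poly_Mapping.single k a, 0)"

definition central :: "complex \<Rightarrow> ('k, 'a::zero) cext"
  where "central c = (0, c)"

text \<open>
  Biadditive extension of a map given on the elements \<open>a e\<^sub>p\<close>, \<open>b e\<^sub>q\<close>, which is zero as soon as
  one of the arguments is central.
\<close>

definition bilin_ext ::
  "('a \<Rightarrow> 'k \<Rightarrow> 'a \<Rightarrow> 'k \<Rightarrow> ('k, 'a) cext) \<Rightarrow> ('k, 'a::ab_group_add) cext \<Rightarrow> ('k, 'a) cext \<Rightarrow> ('k, 'a) cext"
  where "bilin_ext B X Y =
    (\<Sum>p\<in>Poly_Mapping.keys (fst X). \<Sum>q\<in>Poly_Mapping.keys (fst Y).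
       B (Poly_Mapping.lookup (fst X) p) p (Poly_Mapping.lookup (fst Y) q) q)"


section \<open>Representations of Lie algebras\<close>

definition lie_rep ::
  "(complex \<Rightarrow> 'g \<Rightarrow> 'g) \<Rightarrow> ('g \<Rightarrow> 'g \<Rightarrow> 'g) \<Rightarrow> (complex \<Rightarrow> 'm \<Rightarrow> 'm) \<Rightarrow>
   ('g::ab_group_add \<Rightarrow> 'm::ab_group_add \<Rightarrow> 'm) \<Rightarrow> bool"
  where "lie_rep sG br sM \<rho> \<longleftrightarrow>
    (\<forall>x. Vector_Spaces.linear sM sM (\<rho> x)) \<and>
    (\<forall>w. Vector_Spaces.linear sG sM (\<lambda>x. \<rho> x w)) \<and>
    (\<forall>x y w. \<rho> (br x y) w = \<rho> x (\<rho> y w) - \<rho> y (\<rho> x w))"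

definition lie_submodule ::
  "(complex \<Rightarrow> 'm \<Rightarrow> 'm) \<Rightarrow> ('g \<Rightarrow> 'm::ab_group_add \<Rightarrow> 'm) \<Rightarrow> 'm set \<Rightarrow> bool"
  where "lie_submodule sM \<rho> N \<longleftrightarrow> module.subspace sM N \<and> (\<forall>x. \<forall>w\<in>N. \<rho> x w \<in> N)"


section \<open>The Lie algebra of differential operators with coefficients in A\<close>

definition ffact :: "complex \<Rightarrow> nat \<Rightarrow> complex"
  where "ffact \<mu> m = (\<Prod>k<m. \<mu> - of_nat k)"

text \<open>The key \<open>(i, j)\<close> stands for \<open>t\<^sup>i \<partial>\<^sup>j\<close>.\<close>

type_synonym diffop = "(int \<times> nat) \<Rightarrow>\<^sub>0 complex"

text \<open>
  The product \<open>t\<^sup>i \<partial>\<^sup>j \<cdot> t\<^sup>k \<partial>\<^sup>l\<close> in normal form, by the Leibniz rule.  The lemma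
  \<open>diffop_act_monom_times\<close> below confirms that this is the composition of operators on
  Laurent polynomials.
\<close>

fun diffop_monom_times :: "int \<times> nat \<Rightarrow> int \<times> nat \<Rightarrow> diffop"
  where "diffop_monom_times (i1, j1) (i2, j2) =
    (\<Sum>k\<le>j1. Poly_Mapping.single (i1 + i2 - int k, j1 + j2 - k)
                (of_nat (j1 choose k) * ffact (of_int i2) k))"

definition diffop_act :: "diffop \<Rightarrow> (int \<Rightarrow>\<^sub>0 complex) \<Rightarrow> (int \<Rightarrow>\<^sub>0 complex)"
  where "diffop_act D f =
    (\<Sum>p\<in>Poly_Mapping.keys D. \<Sum>n\<in>Poly_Mapping.keys f.
       Poly_Mapping.single (fst p + n - int (snd p))
         (Poly_Mapping.lookup D p * Poly_Mapping.lookup f n * ffact (of_int n) (snd p)))"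

lemma diffop_act_superset:
  assumes "finite A" "Poly_Mapping.keys D \<subseteq> A"
  shows "diffop_act D (Poly_Mapping.single n c) =
    (\<Sum>p\<in>A. Poly_Mapping.single (fst p + n - int (snd p))
       (Poly_Mapping.lookup D p * c * ffact (of_int n) (snd p)))"
proof -
  have "diffop_act D (Poly_Mapping.single n c) =
    (\<Sum>p\<in>Poly_Mapping.keys D. Poly_Mapping.single (fst p + n - int (snd p))
       (Poly_Mapping.lookup D p * c * ffact (of_int n) (snd p)))"
    by (cases "c = 0") (simp_all add: diffop_act_def)
  also have "\<dots> = (\<Sum>p\<in>A. Poly_Mapping.single (fst p + n - int (snd p))
       (Poly_Mapping.lookup D p * c * ffact (of_int n) (snd p)))"
    by (rule sum.mono_neutral_left) (use assms in \<open>auto simp: in_keys_iff\<close>)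
  finally show ?thesis .
qed

lemma diffop_act_add:
  "diffop_act (D + E) (Poly_Mapping.single n c) =
   diffop_act D (Poly_Mapping.single n c) + diffop_act E (Poly_Mapping.single n c)"
proof -
  let ?A = "Poly_Mapping.keys D \<union> Poly_Mapping.keys E"
  have A: "finite ?A" "Poly_Mapping.keys D \<subseteq> ?A" "Poly_Mapping.keys E \<subseteq> ?A"
    "Poly_Mapping.keys (D + E) \<subseteq> ?A"
    using Poly_Mapping.keys_add[of D E] by auto
  show ?thesis
    unfolding diffop_act_superset[OF A(1,2)] diffop_act_superset[OF A(1,3)]
      diffop_act_superset[OF A(1,4)]
    by (simp add: sum.distrib[symmetric] lookup_add algebra_simps single_add[symmetric])
qed

lemma diffop_act_single:
  "diffop_act (Poly_Mapping.single (i, j) d) (Poly_Mapping.single n c) =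
   Poly_Mapping.single (i + n - int j) (d * c * ffact (of_int n) j)"
  by (subst diffop_act_superset[of "{(i, j)}"]) auto

lemma diffop_act_sum:
  "diffop_act (\<Sum>k\<in>K. f k) (Poly_Mapping.single n c) =
   (\<Sum>k\<in>K. diffop_act (f k) (Poly_Mapping.single n c))"
proof (induction K rule: infinite_finite_induct)
  case (insert x F)
  then show ?case by (simp add: diffop_act_add)
qed (simp_all add: diffop_act_def)

lemma ffact_gchoose: "ffact \<mu> m = fact m * (\<mu> gchoose m)"
  by (simp add: ffact_def gbinomial_mult_fact atLeast0LessThan)

lemma ffact_Suc: "ffact \<mu> (Suc m) = ffact \<mu> m * (\<mu> - of_nat m)"
  by (simp add: ffact_def)

lemma ffact_add: "ffact \<mu> (l + m) = ffact \<mu> l * ffact (\<mu> - of_nat l) m"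
  by (induction m) (simp_all add: ffact_Suc algebra_simps, simp add: ffact_def)

lemma ffact_Vandermonde:
  "ffact (\<mu> + \<nu>) j = (\<Sum>k\<le>j. of_nat (j choose k) * ffact \<mu> k * ffact \<nu> (j - k))"
proof -
  have "of_nat (j choose k) * ffact \<mu> k * ffact \<nu> (j - k)
      = fact j * ((\<mu> gchoose k) * (\<nu> gchoose (j - k)))" if "k \<le> j" for k
    using binomial_fact[OF that, where ?'a = complex] by (simp add: ffact_gchoose)
  then have "(\<Sum>k\<le>j. of_nat (j choose k) * ffact \<mu> k * ffact \<nu> (j - k))
      = fact j * (\<Sum>k\<le>j. (\<mu> gchoose k) * (\<nu> gchoose (j - k)))"
    by (simp add: sum_distrib_left)
  also have "\<dots> = ffact (\<mu> + \<nu>) j"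
    by (simp add: gbinomial_Vandermonde atMost_atLeast0 ffact_gchoose)
  finally show ?thesis ..
qed

lemma diffop_act_monom_times:
  "diffop_act (diffop_monom_times p q) (Poly_Mapping.single n c) =
   diffop_act (Poly_Mapping.single p 1) (diffop_act (Poly_Mapping.single q 1) (Poly_Mapping.single n c))"
proof -
  obtain i1 j1 i2 j2 where pq: "p = (i1, j1)" "q = (i2, j2)"
    by fastforce
  let ?e = "i1 + (i2 + n - int j2) - int j1"
  have "diffop_act (diffop_monom_times p q) (Poly_Mapping.single n c) =
    (\<Sum>k\<le>j1. Poly_Mapping.single ?e
       (of_nat (j1 choose k) * ffact (of_int i2) k * c * ffact (of_int n) (j2 + (j1 - k))))"
    unfolding pq diffop_monom_times.simps diffop_act_sum diffop_act_single
    by (rule sum.cong) (auto simp: algebra_simps of_nat_diff)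
  also have "\<dots> = Poly_Mapping.single ?e (\<Sum>k\<le>j1.
       of_nat (j1 choose k) * ffact (of_int i2) k * c * ffact (of_int n) (j2 + (j1 - k)))"
  proof -
    have "(\<Sum>k\<in>K. Poly_Mapping.single ?e (g k)) = Poly_Mapping.single ?e (sum g K)"
      if "finite K" for K and g :: "nat \<Rightarrow> complex"
      using that by (induction K) (simp_all add: single_add)
    then show ?thesis by simp
  qed
  also have "(\<Sum>k\<le>j1.
       of_nat (j1 choose k) * ffact (of_int i2) k * c * ffact (of_int n) (j2 + (j1 - k)))
     = c * ffact (of_int n) j2 * ffact (of_int i2 + (of_int n - of_nat j2)) j1"
    unfolding ffact_Vandermonde ffact_add by (simp add: sum_distrib_left mult_ac)
  finally show ?thesis
    by (simp add: pq diffop_act_single algebra_simps)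
qed

definition tensor_diffop ::
  "(complex \<Rightarrow> 'a \<Rightarrow> 'a) \<Rightarrow> 'a::zero \<Rightarrow> diffop \<Rightarrow> (int \<times> nat, 'a) cext"
  where "tensor_diffop sA a D = (Poly_Mapping.map (\<lambda>c. sA c a) D, 0)"

definition hat_bracket ::
  "(complex \<Rightarrow> 'a \<Rightarrow> 'a) \<Rightarrow> ('a::ring_1 \<Rightarrow> complex) \<Rightarrow>
   (int \<times> nat, 'a) cext \<Rightarrow> (int \<times> nat, 'a) cext \<Rightarrow> (int \<times> nat, 'a) cext"
  where "hat_bracket sA tr = bilin_ext (\<lambda>a (i1, j1) b (i2, j2).
    tensor_diffop sA (a * b) (diffop_monom_times (i1, j1) (i2, j2))
    - tensor_diffop sA (b * a) (diffop_monom_times (i2, j2) (i1, j1))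
    + central ((-1) ^ j1 * (if i1 + i2 = int j1 + int j2 then 1 else 0)
        * fact j1 * fact j2 * (of_int i1 gchoose (j1 + j2 + 1)) * tr (a * b)))"


section \<open>The Lie algebra indexed by pairs of half-integers\<close>

typedef halfint = "{q::rat. \<exists>n::int. q = of_int n + 1/2}"
  morphisms hval Abs_halfint
  by auto

definition int_minus_half :: "int \<Rightarrow> halfint \<Rightarrow> halfint"
  where "int_minus_half n l = Abs_halfint (of_int n - hval l)"

lemma hval_int_minus_half: "hval (int_minus_half n l) = of_int n - hval l"
proof -
  obtain k :: int where k: "hval l = of_int k + 1/2"
    using hval[of l] by auto
  have "of_int n - hval l = of_int (n - k - 1) + (1/2 :: rat)"
    by (simp add: k field_simps)
  then have "of_int n - hval l \<in> {q::rat. \<exists>n::int. q = of_int n + 1/2}"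
    by blast
  then show ?thesis
    unfolding int_minus_half_def by (rule Abs_halfint_inverse)
qed

abbreviation cval :: "halfint \<Rightarrow> complex"
  where "cval l \<equiv> of_rat (hval l)"

definition heaviside :: "halfint \<Rightarrow> complex"
  where "heaviside l = (if hval l > 0 then 1 else 0)"

definition check_bracket ::
  "('a::ring_1 \<Rightarrow> complex) \<Rightarrow>
   (halfint \<times> halfint, 'a) cext \<Rightarrow> (halfint \<times> halfint, 'a) cext \<Rightarrow> (halfint \<times> halfint, 'a) cext"
  where "check_bracket tr = bilin_ext (\<lambda>a (l1, l2) b (k1, k2).
    (if hval l2 + hval k1 = 0 then elt (a * b) (l1, k2) else 0)
    - (if hval l1 + hval k2 = 0 then elt (b * a) (k1, l2) else 0)
    + (if hval l1 + hval k2 = 0 \<and> hval l2 + hval k1 = 0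
       then central ((heaviside l1 * heaviside l2 - heaviside k1 * heaviside k2) * tr (a * b))
       else 0))"

definition check_far ::
  "(complex \<Rightarrow> 'a \<Rightarrow> 'a) \<Rightarrow> nat \<Rightarrow> (halfint \<times> halfint, 'a::ring_1) cext set"
  where "check_far sA m = module.span (cext_scale sA)
    {elt a (i, j) | a i j.
       \<bar>hval i\<bar> > of_nat m \<and> \<bar>hval j\<bar> > of_nat m \<and> hval i * hval j < 0}"


section \<open>The conformal algebra\<close>

text \<open>The key \<open>(m1, m2)\<close> stands for the monomial with these exponents, so \<open>elt a (m1, m2)\<close> is
  \<open>a[m1, m2]\<close>.  \<open>Yplus sA tr u n v\<close> is the coefficient of \<open>z\<^sup>n\<close> in \<open>Y\<^sup>+(u, z) v\<close>.
  The upper limits \<open>m1 + m2 + n1\<close>, \<open>m1 + m2 + n2\<close> make all exponents negative.\<close>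

definition Yplus ::
  "(complex \<Rightarrow> 'a \<Rightarrow> 'a) \<Rightarrow> ('a::ring_1 \<Rightarrow> complex) \<Rightarrow>
   (nat \<times> nat, 'a) cext \<Rightarrow> int \<Rightarrow> (nat \<times> nat, 'a) cext \<Rightarrow> (nat \<times> nat, 'a) cext"
  where "Yplus sA tr u n v = bilin_ext (\<lambda>a (m1, m2) b (n1, n2).
      (\<Sum>p = 0..m1 + m2 + n1.
         if n = int p - int m1 - int m2 - int n1 - 1
         then elt (sA (((- of_nat n1 - 1) gchoose m2) * of_nat (p choose m1)) (a * b)) (p, n2)
         else 0)
    - (\<Sum>q = 0..m1 + m2 + n2.
         if n = int q - int m1 - int m2 - int n2 - 1
         then elt (sA (((- of_nat n2 - 1) gchoose m1) * of_nat (q choose m2)) (b * a)) (n1, q)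
         else 0)
    + (if n = - int m1 - int m2 - int n1 - int n2 - 2
       then central (((- of_nat n1 - 1) gchoose m2) * ((- of_nat n2 - 1) gchoose m1) * tr (a * b))
       else 0)) u v"


section \<open>The constants of the generating function\<close>

text \<open>
  The identity
  \<open>\<Sum> \<Im>\<^bsub>r,s\<^esub> x\<^sup>r y\<^sup>s z\<^bsup>-r-s-1\<^esup> = (x - y)\<^sup>-\<^sup>1 (((z + y) / (z + x))\<^sup>\<iota> - 1)\<close>
  is read, after multiplication by \<open>x - y\<close>, in the ring of power series in \<open>x\<close> (outer variable) and
  \<open>y\<close> (inner variable) over Laurent series in \<open>z\<close>.  The power is
  \<open>(1 + x/z)\<^sup>-\<^sup>\<iota> (1 + y/z)\<^sup>\<iota>\<close> with both factors expanded by the binomial series.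
\<close>

definition ratio_power :: "complex \<Rightarrow> complex fls fps fps"
  where "ratio_power \<iota> =
    Abs_fps (\<lambda>r. fps_const (fls_const (- \<iota> gchoose r) * fls_X_intpow (- int r)))
    * fps_const (Abs_fps (\<lambda>s. fls_const (\<iota> gchoose s) * fls_X_intpow (- int s)))"

definition Im_series :: "(nat \<Rightarrow> nat \<Rightarrow> complex) \<Rightarrow> complex fls fps fps"
  where "Im_series I =
    Abs_fps (\<lambda>r. Abs_fps (\<lambda>s. fls_const (I r s) * fls_X_intpow (- int r - int s - 1)))"

lemma Im_series_eq_iff:
  "(fps_X - fps_const fps_X) * Im_series I = ratio_power \<iota> - 1 \<longleftrightarrow>
   (\<forall>r s. (if r = 0 then 0 else I (r - 1) s) - (if s = 0 then 0 else I r (s - 1))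
      = (- \<iota> gchoose r) * (\<iota> gchoose s) - (if r = 0 \<and> s = 0 then 1 else 0))"
proof -
  have nth: "fls_nth (fls_const a * fls_X_intpow e) m = (if m = e then a else 0)" for a :: complex and e m
    by (auto simp: fls_X_intpow_times_conv_shift)
  have inj: "fls_const a * fls_X_intpow e = fls_const b * (fls_X_intpow e :: complex fls) \<longleftrightarrow> a = b"
    for a b e
    unfolding fls_eq_iff nth by auto
  have L: "fps_nth (fps_nth ((fps_X - fps_const fps_X) * Im_series I) r) s =
    fls_const ((if r = 0 then 0 else I (r - 1) s) - (if s = 0 then 0 else I r (s - 1)))
    * fls_X_intpow (- int r - int s)" for r s
  proof -
    have "fps_nth (fps_nth ((fps_X - fps_const fps_X) * Im_series I) r) s =
      (if r = 0 then 0 else fls_const (I (r - 1) s) * fls_X_intpow (- int (r - 1) - int s - 1)) -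
      (if s = 0 then 0 else fls_const (I r (s - 1)) * fls_X_intpow (- int r - int (s - 1) - 1))"
      by (cases r; cases s) (simp_all add: left_diff_distrib Im_series_def algebra_simps)
    then show ?thesis
      by (simp only: fls_eq_iff nth fls_minus_nth) (auto simp: nth of_nat_diff)
  qed
  have R: "fps_nth (fps_nth (ratio_power \<iota> - 1) r) s =
    fls_const ((- \<iota> gchoose r) * (\<iota> gchoose s) - (if r = 0 \<and> s = 0 then 1 else 0))
    * fls_X_intpow (- int r - int s)" for r s
  proof -
    have mult: "(fls_const a * fls_X_intpow e) * (fls_const b * fls_X_intpow e')
        = fls_const (a * b) * (fls_X_intpow (e + e') :: complex fls)" for a b e e'
      unfolding fls_const_mult_const[symmetric] fls_X_intpow_times_fls_X_intpow[symmetric]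
      by (simp only: mult_ac)
    have "fps_nth (fps_nth (ratio_power \<iota> - 1) r) s =
      (fls_const (- \<iota> gchoose r) * fls_X_intpow (- int r))
      * (fls_const (\<iota> gchoose s) * fls_X_intpow (- int s))
      - (if r = 0 \<and> s = 0 then 1 else 0)"
      by (simp add: ratio_power_def)
    also have "\<dots> = fls_const ((- \<iota> gchoose r) * (\<iota> gchoose s)) * fls_X_intpow (- int r + - int s)
      - (if r = 0 \<and> s = 0 then 1 else 0)"
      unfolding mult ..
    finally show ?thesis
      by (simp only: fls_eq_iff nth fls_minus_nth) (auto simp: nth)
  qed
  show ?thesis
    unfolding fps_eq_iff L R inj ..
qed

lemma Im_const_ex1: "\<exists>!I. (fps_X - fps_const fps_X) * Im_series I = ratio_power \<iota> - 1"
proof -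
  define c where "c r s = (- \<iota> gchoose r) * (\<iota> gchoose s) - (if r = 0 \<and> s = 0 then 1 else 0)"
    for r s
  have vd: "(\<Sum>k\<le>n. c k (n - k)) = 0" for n
  proof -
    have "(\<Sum>k\<le>n. c k (n - k)) = (\<Sum>k\<le>n. (- \<iota> gchoose k) * (\<iota> gchoose (n - k)))
       - (\<Sum>k\<le>n. if k = 0 then (if n = 0 then 1 else 0) else 0)"
      unfolding c_def sum_subtractf by (intro arg_cong2[where f = minus] sum.cong refl) auto
    also have "\<dots> = ((- \<iota> + \<iota>) gchoose n) - (if n = 0 then 1 else 0)"
      by (subst gbinomial_Vandermonde[symmetric]) (simp add: atMost_atLeast0 sum.delta)
    also have "\<dots> = 0"
      by (cases n) auto
    finally show ?thesis .
  qed
  define I where "I r s = (\<Sum>k\<le>s. c (Suc r + k) (s - k))" for r s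
  have ex: "(if r = 0 then 0 else I (r - 1) s) - (if s = 0 then 0 else I r (s - 1)) = c r s" for r s
  proof (cases r; cases s)
    fix s' assume "r = 0" "s = Suc s'"
    then show ?thesis
      using vd[of s] by (simp add: I_def sum.atMost_Suc_shift del: sum.atMost_Suc)
         (simp add: add_eq_0_iff)
  next
    fix r' s' assume "r = Suc r'" "s = Suc s'"
    then show ?thesis
      by (simp add: I_def sum.atMost_Suc_shift del: sum.atMost_Suc)
  qed (use vd[of 0] in \<open>simp_all add: I_def\<close>)
  have un: "J = I" if J: "\<And>r s. (if r = 0 then 0 else J (r - 1) s) - (if s = 0 then 0 else J r (s - 1)) = c r s" for J
  proof -
    have "J r s = I r s" for r s
    proof (induction s arbitrary: r)
      case 0
      show ?case using J[of "Suc r" 0] ex[of "Suc r" 0] by simp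
    next
      case (Suc s)
      show ?case using J[of "Suc r" "Suc s"] ex[of "Suc r" "Suc s"] Suc[of "Suc r"]
        by (simp add: diff_eq_eq)
    qed
    then show ?thesis by blast
  qed
  show ?thesis
    unfolding Im_series_eq_iff c_def[symmetric] using ex un by blast
qed

definition Im_const :: "complex \<Rightarrow> nat \<Rightarrow> nat \<Rightarrow> complex"
  where "Im_const \<iota> =
    (THE I. (fps_X - fps_const fps_X) * Im_series I = ratio_power \<iota> - 1)"


section \<open>The fields on a module\<close>

text \<open>
  \<open>Yiota sM tr \<iota> \<rho> u n w\<close> is the coefficient of \<open>z\<^sup>n\<close> in \<open>Y\<^sup>\<iota>(u, z) w\<close>.  The
  infinite sums are \<^const>\<open>Sum_any\<close>, i.e. sums over the support if that is finite and zero
  otherwise; on the modules considered the supports are finite.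
\<close>

definition Yiota_elt ::
  "(complex \<Rightarrow> 'm \<Rightarrow> 'm) \<Rightarrow> ('a::ring_1 \<Rightarrow> complex) \<Rightarrow> complex \<Rightarrow>
   ((halfint \<times> halfint, 'a) cext \<Rightarrow> 'm::ab_group_add \<Rightarrow> 'm) \<Rightarrow>
   'a \<Rightarrow> nat \<times> nat \<Rightarrow> int \<Rightarrow> 'm \<Rightarrow> 'm"
  where "Yiota_elt sM tr \<iota> \<rho> a = (\<lambda>(r1, r2) n w.
    Sum_any (\<lambda>(i, j).
      if of_int n = - hval i - hval j - of_nat r1 - of_nat r2 - 1
      then sM (((- cval i - \<iota> - 1/2) gchoose r1) * ((- cval j + \<iota> - 1/2) gchoose r2))
             (\<rho> (elt a (i, j)) w)
      else 0)
    + (if n = - int r1 - int r2 - 1 then sM (Im_const \<iota> r1 r2 * tr a) (\<rho> (central 1) w) else 0))"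

definition Yiota ::
  "(complex \<Rightarrow> 'm \<Rightarrow> 'm) \<Rightarrow> ('a::ring_1 \<Rightarrow> complex) \<Rightarrow> complex \<Rightarrow>
   ((halfint \<times> halfint, 'a) cext \<Rightarrow> 'm::ab_group_add \<Rightarrow> 'm) \<Rightarrow>
   (nat \<times> nat, 'a) cext \<Rightarrow> int \<Rightarrow> 'm \<Rightarrow> 'm"
  where "Yiota sM tr \<iota> \<rho> u n w =
    (\<Sum>p\<in>Poly_Mapping.keys (fst u). Yiota_elt sM tr \<iota> \<rho> (Poly_Mapping.lookup (fst u) p) p n w)
    + (if n = 0 then sM (snd u) (\<rho> (central 1) w) else 0)"


section \<open>Formal calculus in three variables\<close>

text \<open>
  A formal series in \<open>z\<^sub>0, z\<^sub>1, z\<^sub>2\<close> is given by its coefficients: \<open>F p0 p1 p2\<close> is the coefficient of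
  \<open>z\<^sub>0\<^bsup>p0\<^esup> z\<^sub>1\<^bsup>p1\<^esup> z\<^sub>2\<^bsup>p2\<^esup>\<close>.
\<close>

definition formal_delta :: "int \<Rightarrow> complex"
  where "formal_delta k = 1"

text \<open>Coefficient of \<open>x\<^sup>p y\<^sup>q\<close> in \<open>(x + y)\<^sup>k\<close>, expanded in nonnegative powers of \<open>y\<close>.\<close>

definition binom_expand :: "int \<Rightarrow> int \<Rightarrow> int \<Rightarrow> complex"
  where "binom_expand k p q = (if q \<ge> 0 \<and> p + q = k then of_int k gchoose nat q else 0)"

text \<open>
  \<open>z\<^sub>1\<^sup>-\<^sup>1 \<delta>((z\<^sub>2 + z\<^sub>0) / z\<^sub>1) = \<Sum>\<^sub>k \<delta>\<^sub>k (z\<^sub>2 + z\<^sub>0)\<^sup>k z\<^sub>1\<^bsup>-k-1\<^esup>\<close>, so only \<open>k = -p1 - 1\<close> contributes to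
  the coefficient of \<open>z\<^sub>1\<^bsup>p1\<^esup>\<close>.
\<close>

definition delta_kernel :: "int \<Rightarrow> int \<Rightarrow> int \<Rightarrow> complex"
  where "delta_kernel p0 p1 p2 =
    formal_delta (- p1 - 1) * binom_expand (- p1 - 1) p2 p0"

definition series_mult ::
  "(complex \<Rightarrow> 'm \<Rightarrow> 'm) \<Rightarrow> (int \<Rightarrow> int \<Rightarrow> int \<Rightarrow> complex) \<Rightarrow>
   (int \<Rightarrow> int \<Rightarrow> int \<Rightarrow> 'm::ab_group_add) \<Rightarrow> int \<Rightarrow> int \<Rightarrow> int \<Rightarrow> 'm"
  where "series_mult sM S F n0 n1 n2 =
    Sum_any (\<lambda>(p0, p1, p2). sM (S p0 p1 p2) (F (n0 - p0) (n1 - p1) (n2 - p2)))"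

definition Res0 :: "(int \<Rightarrow> int \<Rightarrow> int \<Rightarrow> 'm) \<Rightarrow> int \<Rightarrow> int \<Rightarrow> 'm"
  where "Res0 F n1 n2 = F (-1) n1 n2"

text \<open>The series \<open>Y\<^sup>\<iota>(Y\<^sup>+(u, z\<^sub>0) v, z\<^sub>2) w\<close>.\<close>

definition Yiota_Yplus ::
  "(complex \<Rightarrow> 'a \<Rightarrow> 'a) \<Rightarrow> (complex \<Rightarrow> 'm \<Rightarrow> 'm) \<Rightarrow> ('a::ring_1 \<Rightarrow> complex) \<Rightarrow> complex \<Rightarrow>
   ((halfint \<times> halfint, 'a) cext \<Rightarrow> 'm::ab_group_add \<Rightarrow> 'm) \<Rightarrow>
   (nat \<times> nat, 'a) cext \<Rightarrow> (nat \<times> nat, 'a) cext \<Rightarrow> 'm \<Rightarrow> int \<Rightarrow> int \<Rightarrow> int \<Rightarrow> 'm"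
  where "Yiota_Yplus sA sM tr \<iota> \<rho> u v w p0 p1 p2 =
    (if p1 = 0 then Yiota sM tr \<iota> \<rho> (Yplus sA tr u p0 v) p2 w else 0)"

end

theory Submission
  imports Defs
begin

text \<open>
  For a function \<open>f\<close> and an integer \<open>N\<close> consider the mode \<open>\<Sum>\<^sub>i f(i) a(i, N - i)\<close>, with \<open>i\<close> ranging over
  the half-integers.  The generating vectors are killed by all \<open>a(i, j)\<close> with \<open>i\<close> and \<open>j\<close> far out and
  of opposite sign, and moving \<open>a(i, N - i)\<close> past a fixed \<open>b(k, l)\<close> produces extra terms for at most
  two values of \<open>i\<close>.  So on every vector only finitely many terms of a mode survive.  The
  coefficients of \<open>Y\<^sup>\<iota>(a[r\<^sub>1, r\<^sub>2], z)\<close> and the operators \<open>\<sigma>(a \<otimes> t\<^sup>m \<partial>\<^sup>r)\<close> are both such modes, with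
  \<open>f\<close> a product of binomials or a falling factorial, corrected for \<open>N = 0\<close> by a multiple of \<open>tr a\<close>
  times \<open>\<kappa>\<^sub>0\<close>.  Both assertions are therefore cases of one commutator formula (\<open>mode_commutator\<close>):

    \<open>[mode f a N\<^sub>1, mode g b N\<^sub>2] = mode (f(x) g(x - N\<^sub>1)) (ab) N - mode (f(x - N\<^sub>2) g(x)) (ba) N
       + \<delta>\<^bsub>N,0\<^esub> W tr(ab) \<kappa>\<^sub>0\<close>,  with \<open>N = N\<^sub>1 + N\<^sub>2\<close>,

  where \<open>W\<close> is the sum of \<open>f(x) g(x - N\<^sub>1)\<close> over the half-integers between \<open>0\<close> and \<open>N\<^sub>1\<close>, counted
  negatively if \<open>N\<^sub>1 < 0\<close>.

  The coefficients of \<open>ab\<close> and \<open>ba\<close> are matched by identities between polynomials in \<open>x\<close>, both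
  consequences of Vandermonde's convolution: \<open>gchoose_product_expand\<close> produces the sums in \<open>Y\<^sup>+\<close>,
  and \<open>ffact_product_expand\<close> the Leibniz rule for products of differential operators.

  The central terms explain the constants \<open>\<Im>\<^bsub>r,s\<^esub>\<close>.  With \<open>\<iota> = -X\<close> and \<open>z = 1\<close> their generating
  function is \<open>((1 + x)\<^sup>X (1 + y)\<^bsup>-X\<^esup> - 1) / (x - y)\<close>.  Replacing \<open>X\<close> by \<open>X + 1\<close> multiplies the power
  by \<open>(1 + x) / (1 + y) = 1 + (x - y) / (1 + y)\<close>, so the generating function grows by
  \<open>(1 + x)\<^sup>X (1 + y)\<^bsup>-1-X\<^esup>\<close>.  In other words \<open>\<Im>\<^bsub>r,s\<^esub>\<close>, as a function of \<open>X\<close>, is the polynomial that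
  vanishes at \<open>0\<close> and has the difference \<open>binom(X, r) binom(-1 - X, s)\<close> (\<open>Im_const_difference\<close>).
  Hence the sum of the constants that belong to \<open>ab\<close> is the value \<open>G(-\<iota>)\<close> of a polynomial whose
  difference is the summand of \<open>W\<close>, and \<open>W\<close> telescopes to \<open>G(-\<iota>) - G(-\<iota> - N\<^sub>1)\<close>.  The sum of the
  constants that belong to \<open>ba\<close> is \<open>G'(-\<iota>)\<close> for a polynomial \<open>G'\<close> with the same difference as
  \<open>G(X - N\<^sub>1)\<close>.  A polynomial with zero difference is constant, so \<open>G(X - N\<^sub>1) - G'(X)\<close> equals its
  value at \<open>X = 0\<close>.  That value is \<open>G(-N\<^sub>1)\<close>, a sum of products of binomial coefficients with a
  closed form (\<open>antidifference_shift\<close>). It is exactly the negative of what the central term of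
  \<open>Y\<^sup>+\<close>, respectively the cocycle of the Lie algebra of differential operators, contributes.
\<close>

section \<open>Polynomial functions\<close>

definition polyfun :: "(complex \<Rightarrow> complex) \<Rightarrow> bool"
  where "polyfun f \<longleftrightarrow> (\<exists>p. f = poly p)"

lemma polyfun_const: "polyfun (\<lambda>x. c)"
  unfolding polyfun_def by (rule exI[of _ "[:c:]"]) auto

lemma polyfun_ident: "polyfun (\<lambda>x. x)"
  unfolding polyfun_def by (rule exI[of _ "[:0, 1:]"]) auto

lemma polyfun_add: "polyfun f \<Longrightarrow> polyfun g \<Longrightarrow> polyfun (\<lambda>x. f x + g x)"
  unfolding polyfun_def by (auto simp: fun_eq_iff) (metis poly_add)

lemma polyfun_diff: "polyfun f \<Longrightarrow> polyfun g \<Longrightarrow> polyfun (\<lambda>x. f x - g x)"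
  unfolding polyfun_def by (auto simp: fun_eq_iff) (metis poly_diff)

lemma polyfun_mult: "polyfun f \<Longrightarrow> polyfun g \<Longrightarrow> polyfun (\<lambda>x. f x * g x)"
  unfolding polyfun_def by (auto simp: fun_eq_iff) (metis poly_mult)

lemma polyfun_sum: "(\<And>i. i \<in> A \<Longrightarrow> polyfun (f i)) \<Longrightarrow> polyfun (\<lambda>x. \<Sum>i\<in>A. f i x)"
  by (induction A rule: infinite_finite_induct) (simp_all add: polyfun_const polyfun_add)

lemma polyfun_gbinomial:
  assumes "polyfun f"
  shows "polyfun (\<lambda>x. f x gchoose k)"
proof (induction k)
  case (Suc k)
  have "(f x gchoose Suc k) = (f x gchoose k) * (f x - of_nat k) * (1 / of_nat (Suc k))" for x
    using gbinomial_absorb_comp[of "f x" k] gbinomial_absorption[of k "f x"]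
    by (simp add: divide_simps mult_ac del: of_nat_Suc)
  then show ?case
    by (simp only:) (intro polyfun_mult polyfun_diff polyfun_const Suc assms)
qed (simp add: polyfun_const)

lemma polyfun_shift:
  assumes "polyfun f"
  shows "polyfun (\<lambda>x. f (x + c))"
proof -
  obtain p where "f = poly p"
    using assms by (auto simp: polyfun_def)
  then have "(\<lambda>x. f (x + c)) = poly (pcompose p [:c, 1:])"
    by (auto simp: poly_pcompose algebra_simps)
  then show ?thesis
    unfolding polyfun_def by blast
qed

lemmas polyfun_intros = polyfun_const polyfun_ident polyfun_add polyfun_diff polyfun_mult
  polyfun_sum polyfun_gbinomial

text \<open>
  A periodic polynomial takes its value at \<open>0\<close> at infinitely many points.  This is the only reason
  for tracking polynomiality: it turns equality of differences into equality up to a constant.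
\<close>
lemma polyfun_periodic_constant:
  assumes "polyfun f" and per: "\<And>x. f (x + 1) = f x"
  shows "f x = f 0"
proof -
  obtain p where p: "f = poly p"
    using assms by (auto simp: polyfun_def)
  have "f (of_nat n) = f 0" for n
  proof (induction n)
    case (Suc n)
    then show ?case using per[of "of_nat n"] by (simp add: add.commute)
  qed simp
  then have "range of_nat \<subseteq> {x. poly (p - [:f 0:]) x = 0}"
    by (auto simp: p)
  moreover have "infinite (range (of_nat :: nat \<Rightarrow> complex))"
    by (simp add: finite_image_iff inj_on_def)
  ultimately have "p - [:f 0:] = 0"
    using poly_roots_finite finite_subset by blast
  then show ?thesis
    using p by (metis eq_iff_diff_eq_0 poly_0 poly_pCons mult_zero_right add_0_right)
qed

section \<open>Binomial identities\<close>

text \<open>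
  Both sides count the subsets of size \<open>a + b + 1\<close> of \<open>n + 1\<close> points on a line; on the left they are
  sorted by the position of the chosen point that has exactly \<open>a\<close> chosen points before it.  The
  induction uses Pascal's rule in the second factor.
\<close>
lemma sum_choose_mult_choose:
  "(\<Sum>k\<le>n. (k choose a) * ((n - k) choose b)) = (Suc n choose (Suc (a + b)))"
proof (induction n arbitrary: b)
  case 0
  then show ?case by (cases a; cases b) simp_all
next
  case (Suc n)
  show ?case
  proof (cases b)
    case 0
    then show ?thesis
      by (simp del: binomial_Suc_Suc sum.atMost_Suc add: sum_choose_upper)
  next
    case (Suc b')
    have "(\<Sum>k\<le>Suc n. (k choose a) * ((Suc n - k) choose b))
        = (\<Sum>k\<le>n. (k choose a) * ((n - k) choose Suc b') + (k choose a) * ((n - k) choose b'))"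
      using Suc by (simp add: Suc_diff_le algebra_simps)
    then show ?thesis
      by (simp add: sum.distrib Suc.IH Suc del: binomial_Suc_Suc)
        (simp add: binomial_Suc_Suc)
  qed
qed

text \<open>
  Trinomial revision rewrites \<open>binom(p, m\<^sub>1) binom(X, p)\<close> as
  \<open>binom(X, m\<^sub>1) binom(X - m\<^sub>1, p - m\<^sub>1)\<close>, and the remaining sum over \<open>p\<close> is a Vandermonde
  convolution with value \<open>binom(X + N + m\<^sub>2, m\<^sub>2 + n\<^sub>1)\<close>.  A second trinomial revision splits the
  product of this value and the binomial in front of the sum into the last two factors on the
  left; the signs from negating upper arguments cancel.  With \<open>N\<close> the index of a mode, the
  left-hand side is what the commutator of modes contributes to the coefficient of \<open>ab\<close>, and the
  right-hand side is what \<open>Y\<^sup>+\<close> prescribes, both without the factor that contains \<open>n\<^sub>2\<close>.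
\<close>
lemma gchoose_product_expand:
  fixes X :: complex
  shows "(X gchoose m1) * ((- N - 1 - X) gchoose m2) * ((X + N) gchoose n1) =
    ((- of_nat n1 - 1) gchoose m2) * (\<Sum>p = 0..m1 + m2 + n1.
      of_nat (p choose m1) * ((N + of_nat m1 + of_nat m2) gchoose (m1 + m2 + n1 - p)) * (X gchoose p))"
proof -
  let ?K = "N + of_nat m1 + of_nat m2"
  let ?f = "\<lambda>p. of_nat (p choose m1) * (?K gchoose (m1 + m2 + n1 - p)) * (X gchoose p)"
  have "(\<Sum>p = 0..m1 + m2 + n1. ?f p) = (\<Sum>p = m1..m1 + m2 + n1. ?f p)"
    by (rule sum.mono_neutral_right) (auto simp: not_le)
  also have "\<dots> = (\<Sum>j = 0..m2 + n1. ?f (m1 + j))"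
    by (rule sum.reindex_bij_witness[of _ "\<lambda>j. m1 + j" "\<lambda>p. p - m1"]) auto
  also have "\<dots> = (\<Sum>j = 0..m2 + n1. (X gchoose m1) *
      (((X - of_nat m1) gchoose j) * (?K gchoose (m2 + n1 - j))))"
  proof (rule sum.cong[OF refl])
    fix j assume "j \<in> {0..m2 + n1}"
    have "(X gchoose (m1 + j)) * of_nat ((m1 + j) choose m1) =
        (X gchoose m1) * ((X - of_nat m1) gchoose (m1 + j - m1))"
      unfolding binomial_gbinomial by (rule gbinomial_trinomial_revision) simp
    then have "(X gchoose (m1 + j)) * (of_nat (m1 + j) gchoose m1) =
        (X gchoose m1) * ((X - of_nat m1) gchoose j)"
      by (simp add: binomial_gbinomial)
    then show "?f (m1 + j) = (X gchoose m1) *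
      (((X - of_nat m1) gchoose j) * (?K gchoose (m2 + n1 - j)))"
      by (simp add: add.assoc mult.assoc) (simp add: binomial_gbinomial mult_ac)
  qed
  also have "\<dots> = (X gchoose m1) * ((X + N + of_nat m2) gchoose (m2 + n1))"
    unfolding sum_distrib_left[symmetric] gbinomial_Vandermonde by (simp add: algebra_simps)
  finally have S: "(\<Sum>p = 0..m1 + m2 + n1. ?f p) =
    (X gchoose m1) * ((X + N + of_nat m2) gchoose (m2 + n1))" .
  have neg1: "((- N - 1 - X) gchoose m2) = (-1) ^ m2 * ((X + N + of_nat m2) gchoose m2)"
    using gbinomial_negated_upper[of "- N - 1 - X" m2] by (simp add: algebra_simps)
  have neg2: "((- of_nat n1 - 1 :: complex) gchoose m2) = (-1) ^ m2 * (of_nat (m2 + n1) gchoose m2)"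
    using gbinomial_negated_upper[of "- of_nat n1 - 1 :: complex" m2] by (simp add: algebra_simps)
  have "((X + N + of_nat m2) gchoose (m2 + n1)) * (of_nat (m2 + n1) gchoose m2) =
      ((X + N + of_nat m2) gchoose m2) * ((X + N + of_nat m2 - of_nat m2) gchoose (m2 + n1 - m2))"
    by (rule gbinomial_trinomial_revision) simp
  then show ?thesis
    unfolding S neg1 neg2 by (simp add: mult_ac)
qed

lemma choose_negated: "((- 1 - of_nat s :: complex) gchoose n) = (-1) ^ n * of_nat ((s + n) choose n)"
  using gbinomial_negated_upper[of "- 1 - of_nat s :: complex" n]
  by (simp add: binomial_gbinomial algebra_simps)

text \<open>
  Together with \<open>choose_negated\<close> this merges two binomial coefficients whose upper arguments
  depend on the summation index into one, so that \<open>sum_choose_mult_choose\<close> applies.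
\<close>
lemma choose_mult_shifted:
  "(s choose m) * ((s + n) choose n) = ((s + n) choose (m + n)) * ((m + n) choose m)"
proof (cases "m \<le> s")
  case True
  then have "((s + n) choose (m + n)) * ((m + n) choose n) = ((s + n) choose n) * ((s + n - n) choose (m + n - n))"
    by (intro choose_mult) auto
  moreover have "((m + n) choose n) = ((m + n) choose m)"
    using binomial_symmetric[of n "m + n"] by simp
  ultimately show ?thesis by (simp add: mult.commute)
qed (simp add: not_le binomial_eq_0)

text \<open>
  A shifted \<open>sum_choose_mult_choose\<close>: the conditions \<open>n \<le> a\<close> and \<open>k \<le> b\<close> make all its terms outside
  the shifted range vanish.
\<close>
lemma sum_choose_window:
  "(\<Sum>s<M. ((s + n) choose a) * ((M - 1 - s + k) choose b)) = ((M + n + k) choose Suc (a + b))"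
  if "n \<le> a" "k \<le> b" for M n k a b :: nat
proof (cases "M + n + k")
  case 0
  then show ?thesis by simp
next
  case (Suc L)
  have "(\<Sum>s<M. ((s + n) choose a) * ((M - 1 - s + k) choose b))
      = (\<Sum>j\<in>{n..<M + n}. (j choose a) * ((L - j) choose b))"
    by (rule sum.reindex_bij_witness[of _ "\<lambda>j. j - n" "\<lambda>s. s + n"])
      (use Suc in \<open>auto intro!: arg_cong2[where f = "(*)"] arg_cong2[where f = "(choose)"]\<close>)
  also have "\<dots> = (\<Sum>j\<le>L. (j choose a) * ((L - j) choose b))"
  proof (cases "M = 0")
    case True
    have "(j choose a) * (L - j choose b) = 0" if "j \<le> L" for j
      using Suc that \<open>n \<le> a\<close> \<open>k \<le> b\<close> True by (cases "j < a") auto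
    then show ?thesis using True by simp
  next
    case False
    show ?thesis
      by (rule sum.mono_neutral_left) (use Suc that False in auto)
  qed
  finally show ?thesis using Suc by (simp only: sum_choose_mult_choose)
qed

lemma sum_gchoose_window:
  fixes M m1 m2 n1 n2 :: nat
  shows "(\<Sum>s<M. (of_nat s gchoose m1) * (of_nat (M - 1 - s) gchoose m2) *
      ((-1 - of_nat (M - 1 - s)) gchoose n1) * ((-1 - of_nat s :: complex) gchoose n2)) =
    (-1) ^ (n1 + n2) * of_nat ((m1 + n2) choose m1) * of_nat ((m2 + n1) choose m2) *
      of_nat ((M + n2 + n1) choose Suc (m1 + n2 + (m2 + n1)))"
proof -
  have "(of_nat s gchoose m1) * (of_nat t gchoose m2) *
      ((-1 - of_nat t) gchoose n1) * ((-1 - of_nat s :: complex) gchoose n2) =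
      (-1) ^ (n1 + n2) * of_nat ((m1 + n2) choose m1) * of_nat ((m2 + n1) choose m2) *
      of_nat (((s + n2) choose (m1 + n2)) * ((t + n1) choose (m2 + n1)))" for s t
  proof -
    have "(of_nat s gchoose m1) * (of_nat t gchoose m2) *
      ((-1 - of_nat t) gchoose n1) * ((-1 - of_nat s :: complex) gchoose n2) =
      (-1) ^ (n1 + n2) * of_nat ((s choose m1) * ((s + n2) choose n2)) *
        of_nat ((t choose m2) * ((t + n1) choose n1))"
      unfolding choose_negated by (simp add: binomial_gbinomial power_add mult_ac)
    then show ?thesis
      unfolding choose_mult_shifted by (simp add: mult_ac)
  qed
  then show ?thesis
    by (simp only: sum_distrib_left[symmetric] of_nat_sum[symmetric] sum_choose_window[OF le_add2 le_add2])
qed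

section \<open>The constants as antidifferences\<close>

text \<open>
  The defining identity of the generating function, multiplied by \<open>x - y\<close>, coefficient by
  coefficient.
\<close>
lemma Im_const_recurrence:
  "(if r = 0 then 0 else Im_const \<iota> (r - 1) s) - (if s = 0 then 0 else Im_const \<iota> r (s - 1))
    = (- \<iota> gchoose r) * (\<iota> gchoose s) - (if r = 0 \<and> s = 0 then 1 else 0)"
proof -
  have "(fps_X - fps_const fps_X) * Im_series (Im_const \<iota>) = ratio_power \<iota> - 1"
    unfolding Im_const_def by (rule theI'[OF Im_const_ex1])
  then show ?thesis
    unfolding Im_series_eq_iff by blast
qed

lemma Im_const_at_0: "Im_const (- X) r 0 = (X gchoose Suc r)"
  using Im_const_recurrence[of "Suc r" "- X" 0] by simp

lemma Im_const_Suc: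
  "Im_const (- X) r (Suc s) = Im_const (- X) (Suc r) s + (X gchoose Suc r) * (- X gchoose Suc s)"
  using Im_const_recurrence[of "Suc r" "- X" "Suc s"] by (simp add: algebra_simps)

lemma polyfun_Im_const: "polyfun (\<lambda>X. Im_const (- X) r s)"
proof (induction s arbitrary: r)
  case (Suc s)
  have neg: "polyfun (\<lambda>X. - X gchoose Suc s)"
    using polyfun_gbinomial[OF polyfun_diff[OF polyfun_const[of 0] polyfun_ident]] by simp
  show ?case
    unfolding Im_const_Suc by (intro polyfun_intros Suc neg)
qed (simp add: Im_const_at_0 polyfun_intros)

lemma Im_const_zero: "Im_const 0 r s = 0"
proof (induction s arbitrary: r)
  case 0
  then show ?case using Im_const_at_0[of 0 r] by simp
next
  case (Suc s)
  then show ?case using Im_const_Suc[of 0 r s] by simp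
qed

text \<open>
  Since \<open>(1 + x) / (1 + y) - 1 = (x - y) / (1 + y)\<close>, raising the exponent \<open>X\<close> by one adds
  \<open>(1 + x)\<^sup>X (1 + y)\<^bsup>-1-X\<^esup>\<close> to the generating function.  On coefficients this is an induction
  along the recurrence, with Pascal's rule in both factors.
\<close>
lemma Im_const_difference:
  "Im_const (- (X + 1)) r s - Im_const (- X) r s = (X gchoose r) * ((-1 - X) gchoose s)"
proof (induction s arbitrary: r)
  case 0
  then show ?case unfolding Im_const_at_0 gbinomial_Suc_Suc by simp
next
  case (Suc s)
  have *: "(- X gchoose Suc s) = ((- 1 - X) gchoose s) + ((- 1 - X) gchoose Suc s)"
    using gbinomial_Suc_Suc[of "-1 - X" s] by simp
  have "Im_const (- (X + 1)) r (Suc s) - Im_const (- X) r (Suc s) =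
     (Im_const (- (X + 1)) (Suc r) s - Im_const (- X) (Suc r) s)
     + (X + 1 gchoose Suc r) * (- 1 - X gchoose Suc s) - (X gchoose Suc r) * (- X gchoose Suc s)"
    using Im_const_Suc[of "X + 1" r s] Im_const_Suc[of X r s] by (simp add: minus_diff_commute[of X 1])
  then show ?case
    unfolding Suc * gbinomial_Suc_Suc by (simp add: ring_distribs)
qed

section \<open>Antidifferences of products of binomials\<close>

lemma antidifference_sum:
  fixes G P :: "complex \<Rightarrow> complex"
  assumes "\<And>X. G (X + 1) - G X = P X"
  shows "(\<Sum>s<M. P (X + of_nat s)) = G (X + of_nat M) - G X"
proof (induction M)
  case (Suc M)
  then show ?case
    using assms[of "X + of_nat M"] by (simp add: algebra_simps)
qed simp

text \<open>
  The product of the coefficients of \<open>a(l, N - l)\<close> in \<open>a[m\<^sub>1, m\<^sub>2]\<close> and of \<open>b(l - N, -l)\<close> in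
  \<open>b[n\<^sub>1, n\<^sub>2]\<close>, as a function of \<open>X = -l - \<iota> - 1/2\<close>.  Only on such pairs can the cocycle be
  nonzero.
\<close>
definition mode_product :: "nat \<Rightarrow> nat \<Rightarrow> nat \<Rightarrow> nat \<Rightarrow> int \<Rightarrow> complex \<Rightarrow> complex"
  where "mode_product m1 m2 n1 n2 N X =
    (X gchoose m1) * ((- of_int N - 1 - X) gchoose m2) *
    ((X + of_int N) gchoose n1) * ((-1 - X) gchoose n2)"

text \<open>
  Since \<open>G 0 = 0\<close>, the value \<open>G (-N)\<close> is, up to sign, the sum of the differences between \<open>-N\<close> and \<open>0\<close>.
  At the integers in this range two of the four factors of \<open>mode_product\<close> are ordinary binomial
  coefficients and the other two become so after negating the upper argument, which is where the
  signs come from.  The two signs of \<open>N\<close> exchange the roles of \<open>(m\<^sub>1, m\<^sub>2)\<close> and \<open>(n\<^sub>2, n\<^sub>1)\<close>.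
\<close>
lemma antidifference_at_neg_int:
  fixes G :: "complex \<Rightarrow> complex"
  assumes G: "\<And>X. G (X + 1) - G X = mode_product m1 m2 n1 n2 N X" and "G 0 = 0"
  shows "G (- of_int N) = - (((- of_nat n1 - 1) gchoose m2) * ((- of_nat n2 - 1) gchoose m1) *
    ((of_int N + of_nat m1 + of_nat m2) gchoose (m1 + m2 + n1 + n2 + 1)))"
proof -
  have c1: "((- of_nat n1 - 1 :: complex) gchoose m2) = (-1) ^ m2 * of_nat ((m2 + n1) choose m2)"
  proof -
    have "- of_nat n1 - 1 = (-1 - of_nat n1 :: complex)"
      by simp
    then show ?thesis
      by (simp only: choose_negated add.commute)
  qed
  have c2: "((- of_nat n2 - 1 :: complex) gchoose m1) = (-1) ^ m1 * of_nat ((m1 + n2) choose m1)"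
  proof -
    have "- of_nat n2 - 1 = (-1 - of_nat n2 :: complex)"
      by simp
    then show ?thesis
      by (simp only: choose_negated add.commute)
  qed
  have sym: "((a + b) choose a) = ((b + a) choose b)" for a b :: nat
    using binomial_symmetric[of a "a + b"] by (simp add: add.commute)
  have sq: "(-1) ^ k * ((-1) ^ k * x) = (x :: complex)" for k x
    by (simp flip: mult.assoc power_add)
  \<comment> \<open>For \<open>N = M\<close> the sum runs over \<open>-M, \<dots>, -1\<close>, for \<open>N = -M\<close> over \<open>0, \<dots>, M - 1\<close>.\<close>
  consider M where "N = int M" | M where "N = - int M"
    by (metis int_cases2)
  then show ?thesis
  proof cases
    case (1 M)
    have "- G (- of_int N) = (\<Sum>s<M. mode_product m1 m2 n1 n2 N (- of_nat M + of_nat s))"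
      using antidifference_sum[where G = G and P = "mode_product m1 m2 n1 n2 N" and M = M and X = "- of_nat M"] assms 1 by simp
    also have "\<dots> = (\<Sum>s<M. mode_product m1 m2 n1 n2 N (-1 - of_nat s))"
      by (rule sum.reindex_bij_witness[of _ "\<lambda>s. M - 1 - s" "\<lambda>s. M - 1 - s"])
        (auto simp: of_nat_diff algebra_simps)
    also have "\<dots> = (\<Sum>s<M. (of_nat s gchoose n2) * (of_nat (M - 1 - s) gchoose n1) *
      ((-1 - of_nat (M - 1 - s)) gchoose m2) * ((-1 - of_nat s :: complex) gchoose m1))"
      by (rule sum.cong) (auto simp: mode_product_def 1 of_nat_diff algebra_simps)
    finally have "- G (- of_int N) = (\<Sum>s<M. (of_nat s gchoose n2) * (of_nat (M - 1 - s) gchoose n1) *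
      ((-1 - of_nat (M - 1 - s)) gchoose m2) * ((-1 - of_nat s :: complex) gchoose m1))" .
    then have L: "G (- of_int N) = - (\<Sum>s<M. (of_nat s gchoose n2) * (of_nat (M - 1 - s) gchoose n1) *
      ((-1 - of_nat (M - 1 - s)) gchoose m2) * ((-1 - of_nat s :: complex) gchoose m1))"
      by (metis minus_minus)
    have "(of_int N + of_nat m1 + of_nat m2 :: complex) = of_nat (M + m1 + m2)"
      by (simp add: 1)
    then have R: "((of_int N + of_nat m1 + of_nat m2 :: complex) gchoose (m1 + m2 + n1 + n2 + 1)) =
      of_nat ((M + m1 + m2) choose (m1 + m2 + n1 + n2 + 1))"
      by (simp only: binomial_gbinomial)
    have "Suc (n2 + m1 + (n1 + m2)) = m1 + m2 + n1 + n2 + 1"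
      by simp
    then show ?thesis
      unfolding L sum_gchoose_window c1 c2 R sym[of m1 n2] sym[of m2 n1]
      by (simp only: power_add mult_ac)
  next
    case (2 M)
    have "G (- of_int N) = (\<Sum>s<M. mode_product m1 m2 n1 n2 N (of_nat s))"
      using antidifference_sum[where G = G and P = "mode_product m1 m2 n1 n2 N" and M = M and X = 0] assms 2 by simp
    also have "\<dots> = (\<Sum>s<M. (of_nat s gchoose m1) * (of_nat (M - 1 - s) gchoose m2) *
      ((-1 - of_nat (M - 1 - s)) gchoose n1) * ((-1 - of_nat s :: complex) gchoose n2))"
      by (rule sum.cong) (auto simp: mode_product_def 2 of_nat_diff algebra_simps)
    finally have L: "G (- of_int N) = (\<Sum>s<M. (of_nat s gchoose m1) * (of_nat (M - 1 - s) gchoose m2) *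
      ((-1 - of_nat (M - 1 - s)) gchoose n1) * ((-1 - of_nat s :: complex) gchoose n2))" .
    have "of_nat (m1 + m2 + n1 + n2 + 1) - (of_int N + of_nat m1 + of_nat m2) - (1 :: complex)
      = of_nat (M + n2 + n1)"
      by (simp add: 2)
    then have R: "((of_int N + of_nat m1 + of_nat m2 :: complex) gchoose (m1 + m2 + n1 + n2 + 1)) =
      -1 * ((-1) ^ (m1 + m2 + n1 + n2) * of_nat ((M + n2 + n1) choose (m1 + m2 + n1 + n2 + 1)))"
      by (subst gbinomial_negated_upper)
        (simp only: binomial_gbinomial power_add[of _ _ 1] power_one_right mult_ac)
    have "Suc (m1 + n2 + (m2 + n1)) = m1 + m2 + n1 + n2 + 1"
      by simp
    then show ?thesis
      unfolding L sum_gchoose_window c1 c2 R by (simp add: power_add mult_ac sq add_ac)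
  qed
qed

text \<open>
  \<open>G (X - N)\<close> and \<open>G' X\<close> are polynomials with the same difference, hence differ by the value of
  \<open>G (X - N)\<close> at \<open>X = 0\<close>, which \<open>antidifference_at_neg_int\<close> computes.
\<close>
lemma antidifference_shift:
  fixes G G' :: "complex \<Rightarrow> complex"
  assumes G: "polyfun G" "G 0 = 0" "\<And>X. G (X + 1) - G X = mode_product m1 m2 n1 n2 N X"
    and G': "polyfun G'" "G' 0 = 0"
      "\<And>X. G' (X + 1) - G' X = mode_product m1 m2 n1 n2 N (X - of_int N)"
  shows "G (X - of_int N) = G' X
    - ((- of_nat n1 - 1) gchoose m2) * ((- of_nat n2 - 1) gchoose m1) *
      ((of_int N + of_nat m1 + of_nat m2) gchoose (m1 + m2 + n1 + n2 + 1))"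
proof -
  let ?D = "\<lambda>X. G (X - of_int N) - G' X"
  have "polyfun (\<lambda>X. G (X - of_int N))"
    using polyfun_shift[OF G(1), of "- of_int N"] by simp
  then have "polyfun ?D"
    by (intro polyfun_diff G')
  moreover have "?D (X + 1) = ?D X" for X
    using G(3)[of "X - of_int N"] G'(3)[of X] by (simp add: algebra_simps)
  ultimately have "?D X = ?D 0"
    by (rule polyfun_periodic_constant)
  then show ?thesis
    using antidifference_at_neg_int[OF G(3,2)] G'(2) by (simp add: algebra_simps)
qed

section \<open>Half-integers and sums over a window\<close>

definition half :: "int \<Rightarrow> halfint"
  where "half n = Abs_halfint (of_int n + 1/2)"

lemma hval_half: "hval (half n) = of_int n + 1/2"
  unfolding half_def by (rule Abs_halfint_inverse) auto

lemma halfint_cases: obtains n where "l = half n"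
proof -
  obtain n :: int where "hval l = of_int n + 1/2"
    using hval[of l] by auto
  then have "l = half n"
    by (metis hval_half hval_inject)
  then show ?thesis using that by blast
qed

text \<open>
  The value of the cocycle on \<open>a(l, N - l)\<close> and \<open>b(l - N, -l)\<close>, namely
  \<open>H(l) H(N - l) - H(l - N) H(-l)\<close>, apart from the factor \<open>tr(ab)\<close>.
\<close>
definition window :: "int \<Rightarrow> halfint \<Rightarrow> complex"
  where "window N l = (if 0 < hval l \<and> hval l < of_int N then 1 else 0)
    - (if of_int N < hval l \<and> hval l < 0 then 1 else 0)"

lemma window_half:
  "window N (half n) = (if 0 \<le> n \<and> n < N then 1 else 0) - (if N \<le> n \<and> n < 0 then 1 else 0)"
proof -
  have "(0 < of_int n + (1/2::rat)) = (0 \<le> n)" "(of_int n + (1/2::rat) < 0) = (n < 0)"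
    "(of_int n + (1/2::rat) < of_int N) = (n < N)" "(of_int N < of_int n + (1/2::rat)) = (N \<le> n)"
    by linarith+
  then show ?thesis
    by (simp add: window_def hval_half)
qed

lemma window_support: "{l. window N l \<noteq> 0} \<subseteq> half ` ({0..<N} \<union> {N..<0})"
proof
  fix l assume "l \<in> {l. window N l \<noteq> 0}"
  then show "l \<in> half ` ({0..<N} \<union> {N..<0})"
    by (cases l rule: halfint_cases) (auto simp: window_half split: if_splits)
qed

lemma finite_window_support: "finite {l. window N l \<noteq> 0}"
  by (rule finite_subset[OF window_support]) simp

lemma window_sum:
  fixes G P :: "complex \<Rightarrow> complex"
  assumes G: "\<And>X. G (X + 1) - G X = P X"
  shows "Sum_any (\<lambda>l. P (- cval l - \<iota> - 1/2) * window N l) = G (- \<iota>) - G (- \<iota> - of_int N)"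
proof -
  have inj: "inj_on half A" for A
    by (rule inj_onI) (metis hval_half add_right_cancel of_int_eq_iff)
  have cval: "cval (half n) = of_int n + 1/2" for n
    by (simp add: hval_half of_rat_add of_rat_divide)
  have "Sum_any (\<lambda>l. P (- cval l - \<iota> - 1/2) * window N l) =
      (\<Sum>l\<in>half ` ({0..<N} \<union> {N..<0}). P (- cval l - \<iota> - 1/2) * window N l)"
    by (rule Sum_any.expand_superset) (use window_support[of N] in auto)
  also have "\<dots> = (\<Sum>n\<in>{0..<N} \<union> {N..<0}. P (- of_int n - 1 - \<iota>) * window N (half n))"
    by (simp add: sum.reindex[OF inj] cval algebra_simps)
  also have "\<dots> = G (- \<iota>) - G (- \<iota> - of_int N)"
  proof (cases "0 \<le> N")
    case True
    have "(\<Sum>n\<in>{0..<N} \<union> {N..<0}. P (- of_int n - 1 - \<iota>) * window N (half n)) =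
      (\<Sum>s<nat N. P (- \<iota> - of_int N + of_nat s))"
      by (rule sum.reindex_bij_witness[of _ "\<lambda>s. N - 1 - int s" "\<lambda>n. nat (N - 1 - n)"])
        (use True in \<open>auto simp: window_half algebra_simps intro!: arg_cong[where f = P]\<close>)
    then show ?thesis
      using antidifference_sum[where G = G and P = P and M = "nat N" and X = "- \<iota> - of_int N"] G True by simp
  next
    case False
    have "(\<Sum>n\<in>{0..<N} \<union> {N..<0}. P (- of_int n - 1 - \<iota>) * window N (half n)) =
      (\<Sum>s<nat (- N). - P (- \<iota> + of_nat s))"
      by (rule sum.reindex_bij_witness[of _ "\<lambda>s. - 1 - int s" "\<lambda>n. nat (- 1 - n)"])
        (use False in \<open>auto simp: window_half algebra_simps intro!: arg_cong[where f = P]\<close>)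
    then show ?thesis
      using antidifference_sum[where G = G and P = P and M = "nat (- N)" and X = "- \<iota>"] G False by (simp add: sum_negf)
  qed
  finally show ?thesis .
qed

text \<open>
  The sum is \<open>G (-\<iota>) - G (-\<iota> - N)\<close> by telescoping, and \<open>antidifference_shift\<close> replaces the second
  term. The factor \<open>s\<close> absorbs the factorials by which falling factorials differ from binomials.
\<close>
lemma central_window_sum:
  fixes G G' P :: "complex \<Rightarrow> complex"
  assumes s: "s \<noteq> 0"
    and P: "\<And>x. P x = s * mode_product m1 m2 n1 n2 N (- x - \<iota> - 1/2)"
    and G: "polyfun G" "G 0 = 0" "\<And>X. G (X + 1) - G X = s * mode_product m1 m2 n1 n2 N X"
    and G': "polyfun G'" "G' 0 = 0"
      "\<And>X. G' (X + 1) - G' X = s * mode_product m1 m2 n1 n2 N (X - of_int N)"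
  shows "Sum_any (\<lambda>l. P (cval l) * window N l) = G (- \<iota>) - G' (- \<iota>)
    + s * ((- of_nat n1 - 1) gchoose m2) * ((- of_nat n2 - 1) gchoose m1) *
      ((of_int N + of_nat m1 + of_nat m2) gchoose (m1 + m2 + n1 + n2 + 1))"
proof -
  have div: "polyfun (\<lambda>X. H X / s)" if "polyfun H" for H
    using polyfun_mult[OF that polyfun_const[of "1 / s"]] by simp
  have "G (- \<iota> - of_int N) / s = G' (- \<iota>) / s
    - ((- of_nat n1 - 1) gchoose m2) * ((- of_nat n2 - 1) gchoose m1) *
      ((of_int N + of_nat m1 + of_nat m2) gchoose (m1 + m2 + n1 + n2 + 1))"
    by (rule antidifference_shift)
      (use G G' s in \<open>simp_all add: div diff_divide_distrib[symmetric]\<close>)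
  then have "G (- \<iota> - of_int N) = G' (- \<iota>)
    - s * ((- of_nat n1 - 1) gchoose m2) * ((- of_nat n2 - 1) gchoose m1) *
      ((of_int N + of_nat m1 + of_nat m2) gchoose (m1 + m2 + n1 + n2 + 1))"
    using s by (simp add: field_simps)
  moreover have "Sum_any (\<lambda>l. P (cval l) * window N l) = G (- \<iota>) - G (- \<iota> - of_int N)"
    unfolding P by (rule window_sum) (rule G(3))
  ultimately show ?thesis by simp
qed

section \<open>Elements of the central extensions\<close>

lemma elt_zero [simp]: "elt 0 k = 0"
  by (simp add: elt_def zero_prod_def)

lemma elt_add: "elt (a + b) k = elt a k + elt b k"
  by (simp add: elt_def single_add)

lemma central_zero [simp]: "central 0 = 0"
  by (simp add: central_def zero_prod_def)

lemma bilin_ext_elt: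
  assumes "\<And>b. B 0 p b q = 0" "B a p 0 q = 0"
  shows "bilin_ext B (elt a p) (elt b q) = B a p b q"
  using assms by (auto simp: bilin_ext_def elt_def)

text \<open>
  Reduces identities about brackets and products of arbitrary elements to elements \<open>a e\<^sub>p\<close>, \<open>b e\<^sub>q\<close>.
\<close>
lemma bilin_ext_expand:
  assumes "\<And>a p b q. a = 0 \<or> b = 0 \<Longrightarrow> B a p b q = 0"
  shows "bilin_ext B X Y = (\<Sum>p\<in>Poly_Mapping.keys (fst X). \<Sum>q\<in>Poly_Mapping.keys (fst Y).
    bilin_ext B (elt (Poly_Mapping.lookup (fst X) p) p) (elt (Poly_Mapping.lookup (fst Y) q) q))"
proof -
  have "bilin_ext B (elt a p) (elt b q) = B a p b q" for a p b q
    using assms by (intro bilin_ext_elt) auto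
  then show ?thesis
    by (simp add: bilin_ext_def)
qed

lemma bilin_ext_central:
  "bilin_ext B (central c) Y = 0" "bilin_ext B X (central c) = 0"
  by (simp_all add: bilin_ext_def central_def)

context trace_algebra
begin

lemma tr_zero [simp]: "tr 0 = 0"
  and tr_add: "tr (a + b) = tr a + tr b"
  and tr_scale: "tr (sA c a) = c * tr a"
proof -
  interpret Vector_Spaces.linear sA "(*)" tr by (rule tr_linear)
  show "tr 0 = 0" "tr (a + b) = tr a + tr b" "tr (sA c a) = c * tr a"
    by (rule zero add scale)+
qed

lemma elt_scale: "elt (sA c a) k = cext_scale sA c (elt a k)"
  by (simp add: elt_def cext_scale_def)

lemma lookup_map_scale: "Poly_Mapping.lookup (Poly_Mapping.map (sA c) p) k = sA c (Poly_Mapping.lookup p k)"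
  by (simp add: Poly_Mapping.map.rep_eq when_def)

lemma central_scale: "central c = cext_scale sA c (central 1)"
  by (simp add: central_def cext_scale_def prod_eq_iff poly_mapping_eq_iff fun_eq_iff lookup_map_scale)

lemma vector_space_cext: "vector_space (cext_scale sA :: complex \<Rightarrow> ('k, 'a) cext \<Rightarrow> _)"
  by unfold_locales
    (simp_all add: cext_scale_def prod_eq_iff poly_mapping_eq_iff fun_eq_iff lookup_map_scale
      lookup_add scale_right_distrib scale_left_distrib distrib_left distrib_right)

end

lemma check_bracket_elt:
  "check_bracket tr (elt a (l1, l2)) (elt b (k1, k2)) =
    (if hval l2 + hval k1 = 0 then elt (a * b) (l1, k2) else 0)
    - (if hval l1 + hval k2 = 0 then elt (b * a) (k1, l2) else 0)
    + (if hval l1 + hval k2 = 0 \<and> hval l2 + hval k1 = 0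
       then central ((heaviside l1 * heaviside l2 - heaviside k1 * heaviside k2) * tr (a * b))
       else 0)" if "tr 0 = 0"
  unfolding check_bracket_def by (subst bilin_ext_elt) (simp_all add: that)

definition shift_half :: "int \<Rightarrow> halfint \<Rightarrow> halfint"
  where "shift_half n l = int_minus_half 0 (int_minus_half n l)"

lemma hval_shift_half: "hval (shift_half n l) = hval l - of_int n"
  by (simp add: shift_half_def hval_int_minus_half)

locale check_rep = trace_algebra sA tr + M: vector_space sM
  for sA :: "complex \<Rightarrow> 'a::ring_1 \<Rightarrow> 'a" and tr :: "'a \<Rightarrow> complex"
    and sM :: "complex \<Rightarrow> 'm::ab_group_add \<Rightarrow> 'm" +
  fixes \<rho> :: "(halfint \<times> halfint, 'a) cext \<Rightarrow> 'm \<Rightarrow> 'm"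
  assumes rep: "lie_rep (cext_scale sA) (check_bracket tr) sM \<rho>"
begin

lemma rho_linear: "Vector_Spaces.linear sM sM (\<rho> x)"
  and rho_linear_left: "Vector_Spaces.linear (cext_scale sA) sM (\<lambda>x. \<rho> x w)"
  and rho_bracket: "\<rho> (check_bracket tr x y) w = \<rho> x (\<rho> y w) - \<rho> y (\<rho> x w)"
  using rep unfolding lie_rep_def by blast+

lemma rho_add: "\<rho> x (v + w) = \<rho> x v + \<rho> x w"
  and rho_scale: "\<rho> x (sM c w) = sM c (\<rho> x w)"
  and rho_zero [simp]: "\<rho> x 0 = 0"
  and rho_sum: "\<rho> x (\<Sum>i\<in>A. h i) = (\<Sum>i\<in>A. \<rho> x (h i))"
proof -
  interpret Vector_Spaces.linear sM sM "\<rho> x" by (rule rho_linear)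
  show "\<rho> x (v + w) = \<rho> x v + \<rho> x w" "\<rho> x (sM c w) = sM c (\<rho> x w)" "\<rho> x 0 = 0"
    "\<rho> x (\<Sum>i\<in>A. h i) = (\<Sum>i\<in>A. \<rho> x (h i))"
    by (rule add scale zero sum)+
qed

lemma rho_add_left: "\<rho> (x + y) w = \<rho> x w + \<rho> y w"
  and rho_diff_left: "\<rho> (x - y) w = \<rho> x w - \<rho> y w"
  and rho_scale_left: "\<rho> (cext_scale sA c x) w = sM c (\<rho> x w)"
  and rho_zero_left [simp]: "\<rho> 0 w = 0"
proof -
  interpret Vector_Spaces.linear "cext_scale sA" sM "\<lambda>x. \<rho> x w" by (rule rho_linear_left)
  show "\<rho> (x + y) w = \<rho> x w + \<rho> y w" "\<rho> (x - y) w = \<rho> x w - \<rho> y w"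
    "\<rho> (cext_scale sA c x) w = sM c (\<rho> x w)" "\<rho> 0 w = 0"
    by (rule add diff scale zero)+
qed

lemma rho_central: "\<rho> (central c) w = sM c (\<rho> (central 1) w)"
  by (subst central_scale) (rule rho_scale_left)

lemma rho_central_commute: "\<rho> x (\<rho> (central 1) w) = \<rho> (central 1) (\<rho> x w)"
  using rho_bracket[of x "central 1" w] by (simp add: check_bracket_def bilin_ext_central)

text \<open>
  The bracket of elements on the lines \<open>i + j = N\<^sub>1\<close> and \<open>k + l = N\<^sub>2\<close>, written in the first
  indices: each Kronecker delta pairs every \<open>i\<close> with a single \<open>k\<close>, and both deltas hold together
  only if \<open>N\<^sub>1 + N\<^sub>2 = 0\<close>.
\<close>
lemma rho_elt_commutator:
  "\<rho> (elt a (i, int_minus_half N1 i)) (\<rho> (elt b (k, int_minus_half N2 k)) w)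
   - \<rho> (elt b (k, int_minus_half N2 k)) (\<rho> (elt a (i, int_minus_half N1 i)) w) =
   (if k = shift_half N1 i then \<rho> (elt (a * b) (i, int_minus_half (N1 + N2) i)) w else 0)
   - (if i = shift_half N2 k then \<rho> (elt (b * a) (k, int_minus_half (N1 + N2) k)) w else 0)
   + (if k = shift_half N1 i \<and> N1 + N2 = 0
      then sM (window N1 i * tr (a * b)) (\<rho> (central 1) w) else 0)"
proof -
  have 1: "hval (int_minus_half N1 i) + hval k = 0 \<longleftrightarrow> k = shift_half N1 i"
    "hval i + hval (int_minus_half N2 k) = 0 \<longleftrightarrow> i = shift_half N2 k"
    by (auto simp: hval_int_minus_half hval_shift_half hval_inject[symmetric])
  have 2: "int_minus_half N2 k = int_minus_half (N1 + N2) i" if "k = shift_half N1 i"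
    by (simp add: that hval_int_minus_half hval_shift_half hval_inject[symmetric])
  have 3: "int_minus_half N1 i = int_minus_half (N1 + N2) k" if "i = shift_half N2 k"
    by (simp add: that hval_int_minus_half hval_shift_half hval_inject[symmetric])
  have 4: "(i = shift_half N2 k \<and> k = shift_half N1 i) \<longleftrightarrow> (k = shift_half N1 i \<and> N1 + N2 = 0)"
    by (auto simp: hval_shift_half hval_inject[symmetric] simp flip: of_int_add)
  have 5: "heaviside i * heaviside (int_minus_half N1 i)
      - heaviside k * heaviside (int_minus_half N2 k) = window N1 i"
    if "k = shift_half N1 i" "N1 + N2 = 0"
    using that by (auto simp: heaviside_def window_def hval_int_minus_half hval_shift_half
        simp flip: of_int_add eq_neg_iff_add_eq_0)
  show ?thesis
    unfolding rho_bracket[symmetric] check_bracket_elt[where tr = tr, OF tr_zero] 1 4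
    using 2 3 5 by (auto simp: rho_add_left rho_diff_left rho_central[of "_ * _"] rho_central[of "tr _"])
qed

end

section \<open>Modules generated by vectors that far elements annihilate\<close>

text \<open>
  The condition that makes all infinite sums below finite on each vector;
  \<open>generated_imp_restricted\<close> derives it for modules generated by vectors that \<open>check_far\<close>
  annihilates.
\<close>
locale restricted_rep = check_rep sA tr sM \<rho>
  for sA :: "complex \<Rightarrow> 'a::ring_1 \<Rightarrow> 'a" and tr :: "'a \<Rightarrow> complex"
    and sM :: "complex \<Rightarrow> 'm::ab_group_add \<Rightarrow> 'm"
    and \<rho> :: "(halfint \<times> halfint, 'a) cext \<Rightarrow> 'm \<Rightarrow> 'm" +
  assumes restricted: "finite {(i, j). hval i + hval j = of_int n \<and> \<rho> (elt a (i, j)) w \<noteq> 0}"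

lemma sum_single_lookup:
  "(\<Sum>k\<in>Poly_Mapping.keys p. Poly_Mapping.single k (Poly_Mapping.lookup p k)) = p"
  by (rule poly_mapping_eqI) (simp add: lookup_sum lookup_single when_def in_keys_iff)

lemma cext_expand:
  "(\<Sum>k\<in>Poly_Mapping.keys (fst X). elt (Poly_Mapping.lookup (fst X) k) k) + central (snd X) = X"
  by (simp add: prod_eq_iff fst_sum snd_sum elt_def central_def sum_single_lookup)

lemma finite_bounded_halfint: "finite {i. \<bar>hval i\<bar> \<le> of_int B}"
proof (rule finite_subset)
  show "{i. \<bar>hval i\<bar> \<le> of_int B} \<subseteq> half ` {- B - 1..B}"
  proof
    fix i assume i: "i \<in> {i. \<bar>hval i\<bar> \<le> of_int B}"
    obtain n where n: "i = half n" by (rule halfint_cases)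
    have "of_int (- B - 1) \<le> (of_int n :: rat)" "of_int n \<le> (of_int B :: rat)"
      using i unfolding n by (auto simp: hval_half abs_le_iff)
    then show "i \<in> half ` {- B - 1..B}"
      unfolding n of_int_le_iff by (intro imageI) simp
  qed
qed simp

lemma halfint_pair_sum: obtains N where "l = int_minus_half N k"
proof -
  obtain m n :: int where "hval k = of_int m + 1/2" "hval l = of_int n + 1/2"
    using hval[of k] hval[of l] by auto
  then have "l = int_minus_half (m + n + 1) k"
    by (simp add: hval_int_minus_half hval_inject[symmetric])
  then show ?thesis using that by blast
qed

context check_rep
begin

definition restricted_vectors :: "'m set"
  where "restricted_vectors = {w. \<forall>a n. finite {i. \<rho> (elt a (i, int_minus_half n i)) w \<noteq> 0}}"

lemma restricted_vectors_subspace: "M.subspace restricted_vectors"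
proof (rule M.subspaceI)
  show "0 \<in> restricted_vectors"
    by (simp add: restricted_vectors_def)
next
  fix v w assume vw: "v \<in> restricted_vectors" "w \<in> restricted_vectors"
  have "finite {i. \<rho> (elt a (i, int_minus_half n i)) (v + w) \<noteq> 0}" for a n
    by (rule finite_subset[of _ "{i. \<rho> (elt a (i, int_minus_half n i)) v \<noteq> 0} \<union>
        {i. \<rho> (elt a (i, int_minus_half n i)) w \<noteq> 0}"])
      (use vw in \<open>auto simp: restricted_vectors_def rho_add\<close>)
  then show "v + w \<in> restricted_vectors"
    by (simp add: restricted_vectors_def)
next
  fix c w assume w: "w \<in> restricted_vectors"
  have "finite {i. \<rho> (elt a (i, int_minus_half n i)) (sM c w) \<noteq> 0}" for a n
    by (rule finite_subset[of _ "{i. \<rho> (elt a (i, int_minus_half n i)) w \<noteq> 0}"])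
      (use w in \<open>auto simp: restricted_vectors_def rho_scale\<close>)
  then show "sM c w \<in> restricted_vectors"
    by (simp add: restricted_vectors_def)
qed

text \<open>
  By \<open>rho_elt_commutator\<close>, moving \<open>a(i, n - i)\<close> past \<open>b(k, l)\<close> yields extra terms for at most two
  values of \<open>i\<close>.
\<close>
lemma restricted_vectors_elt:
  assumes w: "w \<in> restricted_vectors"
  shows "\<rho> (elt b (k, l)) w \<in> restricted_vectors"
proof -
  obtain N where l: "l = int_minus_half N k"
    by (rule halfint_pair_sum)
  have "finite {i. \<rho> (elt a (i, int_minus_half n i)) (\<rho> (elt b (k, l)) w) \<noteq> 0}" for a n
  proof (rule finite_subset)
    let ?S = "{i. \<rho> (elt a (i, int_minus_half n i)) w \<noteq> 0}"
    show "{i. \<rho> (elt a (i, int_minus_half n i)) (\<rho> (elt b (k, l)) w) \<noteq> 0}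
      \<subseteq> ?S \<union> {shift_half (- n) k, shift_half N k}"
    proof clarify
      fix i
      assume nz: "\<rho> (elt a (i, int_minus_half n i)) (\<rho> (elt b (k, l)) w) \<noteq> 0"
        and i: "i \<notin> {}" "i \<noteq> shift_half N k" "i \<noteq> shift_half (- n) k"
        and z: "\<rho> (elt a (i, int_minus_half n i)) w = 0"
      have "k \<noteq> shift_half n i"
        using i(3) by (auto simp: hval_inject[symmetric] hval_shift_half)
      then show False
        using rho_elt_commutator[of a i n b k N w] i z nz unfolding l by simp
    qed
    show "finite (?S \<union> {shift_half (- n) k, shift_half N k})"
      using w by (simp add: restricted_vectors_def)
  qed
  then show ?thesis
    by (simp add: restricted_vectors_def)
qed

lemma restricted_vectors_submodule: "lie_submodule sM \<rho> restricted_vectors"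
  unfolding lie_submodule_def
proof (intro conjI allI ballI)
  show "module.subspace sM restricted_vectors"
    by (rule restricted_vectors_subspace)
next
  fix x w assume w: "w \<in> restricted_vectors"
  have central: "\<rho> (central c) w \<in> restricted_vectors" for c
  proof -
    have "finite {i. \<rho> (elt a (i, int_minus_half n i)) (\<rho> (central c) w) \<noteq> 0}" for a n
      by (rule finite_subset[of _ "{i. \<rho> (elt a (i, int_minus_half n i)) w \<noteq> 0}"])
        (use w in \<open>auto simp: restricted_vectors_def rho_central[of c] rho_scale rho_central_commute\<close>)
    then show ?thesis
      by (simp add: restricted_vectors_def)
  qed
  have sum: "\<rho> (\<Sum>k\<in>K. elt (h k) k) w \<in> restricted_vectors" for K h
  proof (induction K rule: infinite_finite_induct)
    case (insert k K)
    then show ?case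
      by (cases k) (simp add: rho_add_left M.subspace_add[OF restricted_vectors_subspace]
          restricted_vectors_elt[OF w])
  qed (simp_all add: M.subspace_0[OF restricted_vectors_subspace])
  show "\<rho> x w \<in> restricted_vectors"
    by (subst cext_expand[symmetric], unfold rho_add_left)
      (intro M.subspace_add[OF restricted_vectors_subspace] sum central)
qed

text \<open>
  On the line \<open>i + j = n\<close>, all points with \<open>\<bar>i\<bar> > m + \<bar>n\<bar>\<close> have \<open>\<bar>j\<bar> > m\<close> and \<open>j\<close> of the opposite sign.
\<close>
lemma restricted_vectors_vacuum:
  assumes "\<And>x. x \<in> check_far sA m \<Longrightarrow> \<rho> x w = 0"
  shows "w \<in> restricted_vectors"
proof -
  interpret C: module "cext_scale sA :: complex \<Rightarrow> (halfint \<times> halfint, 'a) cext \<Rightarrow> _"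
    using vector_space_cext by (rule module_iff_vector_space[THEN iffD2])
  have "finite {i. \<rho> (elt a (i, int_minus_half n i)) w \<noteq> 0}" for a n
  proof (rule finite_subset[OF _ finite_bounded_halfint])
    show "{i. \<rho> (elt a (i, int_minus_half n i)) w \<noteq> 0} \<subseteq> {i. \<bar>hval i\<bar> \<le> of_int (int m + \<bar>n\<bar>)}"
    proof (rule subsetI, rule ccontr)
      fix i
      assume i: "i \<in> {i. \<rho> (elt a (i, int_minus_half n i)) w \<noteq> 0}"
        and "i \<notin> {i. \<bar>hval i\<bar> \<le> of_int (int m + \<bar>n\<bar>)}"
      then have far: "of_nat m + of_int \<bar>n\<bar> < \<bar>hval i\<bar>"
        by simp
      then have "of_nat m < \<bar>hval i\<bar>" "of_nat m < \<bar>hval (int_minus_half n i)\<bar>"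
        by (auto simp: hval_int_minus_half abs_if split: if_splits)
      moreover have "hval i * hval (int_minus_half n i) < 0"
        using far unfolding hval_int_minus_half mult_less_0_iff by (auto simp: abs_if split: if_splits)
      ultimately have "elt a (i, int_minus_half n i) \<in> check_far sA m"
        unfolding check_far_def by (intro C.span_base) blast
      then show False
        using assms i by auto
    qed
  qed
  then show ?thesis
    by (simp add: restricted_vectors_def)
qed

text \<open>
  The restricted vectors form a submodule that contains the generators.
\<close>
lemma generated_imp_restricted:
  assumes gen: "lie_submodule sM \<rho> hull M0 = UNIV"
    and far: "\<And>x w. x \<in> check_far sA m \<Longrightarrow> w \<in> M0 \<Longrightarrow> \<rho> x w = 0"
  shows "restricted_rep sA tr sM \<rho>"
proof
  fix n a w
  have "lie_submodule sM \<rho> hull M0 \<subseteq> restricted_vectors"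
  proof (rule hull_minimal)
    show "M0 \<subseteq> restricted_vectors"
      by (rule subsetI, rule restricted_vectors_vacuum, rule far)
  qed (rule restricted_vectors_submodule)
  then have "finite {i. \<rho> (elt a (i, int_minus_half n i)) w \<noteq> 0}"
    unfolding gen by (auto simp: restricted_vectors_def)
  then show "finite {(i, j). hval i + hval j = of_int n \<and> \<rho> (elt a (i, j)) w \<noteq> 0}"
  proof (rule finite_surj[where f = "\<lambda>i. (i, int_minus_half n i)"])
    have "j = int_minus_half n i" if "hval i + hval j = of_int n" for i j
      using that by (simp add: hval_int_minus_half hval_inject[symmetric])
    then show "{(i, j). hval i + hval j = of_int n \<and> \<rho> (elt a (i, j)) w \<noteq> 0} \<subseteq>
      (\<lambda>i. (i, int_minus_half n i)) ` {i. \<rho> (elt a (i, int_minus_half n i)) w \<noteq> 0}"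
      by auto
  qed
qed

end

section \<open>Modes and their commutators\<close>

context restricted_rep
begin

lemma finite_mode_support:
  "finite {i. \<rho> (elt a (i, int_minus_half N i)) w \<noteq> 0}"
  by (rule finite_subset[OF _ finite_imageI[OF restricted[of N a w], of fst]])
    (force simp: hval_int_minus_half image_iff)

definition mode :: "(complex \<Rightarrow> complex) \<Rightarrow> 'a \<Rightarrow> int \<Rightarrow> 'm \<Rightarrow> 'm"
  where "mode f a N w =
    Sum_any (\<lambda>i. sM (f (cval i)) (\<rho> (elt a (i, int_minus_half N i)) w))"

lemma mode_superset:
  assumes "finite S" "{i. \<rho> (elt a (i, int_minus_half N i)) w \<noteq> 0} \<subseteq> S"
  shows "mode f a N w = (\<Sum>i\<in>S. sM (f (cval i)) (\<rho> (elt a (i, int_minus_half N i)) w))"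
  unfolding mode_def by (rule Sum_any.expand_superset) (use assms in auto)

text \<open>
  On a fixed vector \<open>w\<close> both compositions are sums over one common finite box \<open>I \<times> K\<close> of index
  pairs, chosen large enough to contain all nonzero terms and to be compatible with the pairings
  of \<open>i\<close> with \<open>k\<close> in \<open>rho_elt_commutator\<close>.  Inside the box the bracket can be applied termwise, and
  each Kronecker delta removes one of the two summations.
\<close>
lemma mode_commutator:
  "mode f a N1 (mode g b N2 w) - mode g b N2 (mode f a N1 w) =
    mode (\<lambda>x. f x * g (x - of_int N1)) (a * b) (N1 + N2) w
    - mode (\<lambda>x. f (x - of_int N2) * g x) (b * a) (N1 + N2) w
    + (if N1 + N2 = 0
       then sM (Sum_any (\<lambda>l. f (cval l) * g (cval l - of_int N1) * window N1 l) * tr (a * b))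
         (\<rho> (central 1) w) else 0)"
proof -
  define \<alpha> where "\<alpha> i = \<rho> (elt a (i, int_minus_half N1 i))" for i
  define \<beta> where "\<beta> k = \<rho> (elt b (k, int_minus_half N2 k))" for k
  define T where "T i = \<rho> (elt (a * b) (i, int_minus_half (N1 + N2) i)) w" for i
  define U where "U k = \<rho> (elt (b * a) (k, int_minus_half (N1 + N2) k)) w" for k
  define \<kappa>w where "\<kappa>w = \<rho> (central 1) w"
  define B0 where "B0 = {k. \<beta> k w \<noteq> 0}"
  define A0 where "A0 = {i. \<alpha> i w \<noteq> 0}"
  \<comment> \<open>\<open>I0\<close> and \<open>K0\<close> carry the terms that the bracket produces; their shifts enter \<open>K\<close> and \<open>I\<close>
    so that the partner of each such index lies in the box.\<close>
  define I0 where "I0 = {i. T i \<noteq> 0} \<union> {i. window N1 i \<noteq> 0}"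
  define K0 where "K0 = {k. U k \<noteq> 0}"
  define I where "I = A0 \<union> (\<Union>k\<in>B0. {i. \<alpha> i (\<beta> k w) \<noteq> 0}) \<union> I0 \<union> shift_half N2 ` K0"
  define K where "K = B0 \<union> (\<Union>i\<in>A0. {k. \<beta> k (\<alpha> i w) \<noteq> 0}) \<union> K0 \<union> shift_half N1 ` I0"
  have fin0: "finite A0" "finite B0" "finite I0" "finite K0"
    unfolding A0_def B0_def I0_def K0_def \<alpha>_def \<beta>_def T_def U_def
    by (simp_all add: finite_mode_support finite_window_support)
  have fin: "finite I" "finite K"
    using fin0 unfolding I_def K_def by (simp_all add: \<alpha>_def \<beta>_def finite_mode_support)
  let ?f = "\<lambda>i. f (cval i)" and ?g = "\<lambda>k. g (cval k)"
  have mode_K: "mode g b N2 w = (\<Sum>k\<in>K. sM (?g k) (\<beta> k w))"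
    unfolding \<beta>_def by (rule mode_superset[OF fin(2)]) (auto simp: K_def B0_def \<beta>_def)
  have mode_I: "mode f a N1 w = (\<Sum>i\<in>I. sM (?f i) (\<alpha> i w))"
    unfolding \<alpha>_def by (rule mode_superset[OF fin(1)]) (auto simp: I_def A0_def \<alpha>_def)
  have \<alpha>_mode: "\<alpha> i (mode g b N2 w) = (\<Sum>k\<in>K. sM (?g k) (\<alpha> i (\<beta> k w)))" for i
    unfolding mode_K \<alpha>_def by (simp add: rho_sum rho_scale)
  have \<beta>_mode: "\<beta> k (mode f a N1 w) = (\<Sum>i\<in>I. sM (?f i) (\<beta> k (\<alpha> i w)))" for k
    unfolding mode_I \<beta>_def by (simp add: rho_sum rho_scale)
  have zero_\<alpha>: "\<alpha> i (\<beta> k w) = 0" if "i \<notin> I" for i k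
    using that by (cases "k \<in> B0") (auto simp: I_def B0_def \<alpha>_def)
  have zero_\<beta>: "\<beta> k (\<alpha> i w) = 0" if "k \<notin> K" for i k
    using that by (cases "i \<in> A0") (auto simp: K_def A0_def \<beta>_def)
  have "mode f a N1 (mode g b N2 w) = (\<Sum>i\<in>I. sM (?f i) (\<alpha> i (mode g b N2 w)))"
    unfolding \<alpha>_def by (rule mode_superset[OF fin(1)])
      (use \<alpha>_mode zero_\<alpha> in \<open>force simp: \<alpha>_def\<close>)
  also have "\<dots> = (\<Sum>i\<in>I. \<Sum>k\<in>K. sM (?f i * ?g k) (\<alpha> i (\<beta> k w)))"
    by (simp add: \<alpha>_mode M.scale_sum_right)
  finally have 1: "mode f a N1 (mode g b N2 w) =
    (\<Sum>i\<in>I. \<Sum>k\<in>K. sM (?f i * ?g k) (\<alpha> i (\<beta> k w)))" .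
  have "mode g b N2 (mode f a N1 w) = (\<Sum>k\<in>K. sM (?g k) (\<beta> k (mode f a N1 w)))"
    unfolding \<beta>_def by (rule mode_superset[OF fin(2)])
      (use \<beta>_mode zero_\<beta> in \<open>force simp: \<beta>_def\<close>)
  also have "\<dots> = (\<Sum>k\<in>K. \<Sum>i\<in>I. sM (?f i * ?g k) (\<beta> k (\<alpha> i w)))"
    by (simp add: \<beta>_mode M.scale_sum_right mult.commute)
  also have "\<dots> = (\<Sum>i\<in>I. \<Sum>k\<in>K. sM (?f i * ?g k) (\<beta> k (\<alpha> i w)))"
    by (rule sum.swap)
  finally have 2: "mode g b N2 (mode f a N1 w) =
    (\<Sum>i\<in>I. \<Sum>k\<in>K. sM (?f i * ?g k) (\<beta> k (\<alpha> i w)))" .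
  let ?c = "\<lambda>i. if N1 + N2 = 0 then sM (window N1 i * tr (a * b)) \<kappa>w else 0"
  have "sM (?f i * ?g k) (\<alpha> i (\<beta> k w)) - sM (?f i * ?g k) (\<beta> k (\<alpha> i w)) =
      (if shift_half N1 i = k then sM (?f i * ?g k) (T i) else 0)
      - (if shift_half N2 k = i then sM (?f i * ?g k) (U k) else 0)
      + (if shift_half N1 i = k then sM (?f i * ?g k) (?c i) else 0)" for i k
    unfolding M.scale_right_diff_distrib[symmetric] \<alpha>_def \<beta>_def rho_elt_commutator
    by (auto simp: T_def U_def \<kappa>w_def M.scale_right_diff_distrib M.scale_right_distrib)
  then have "mode f a N1 (mode g b N2 w) - mode g b N2 (mode f a N1 w) =
      (\<Sum>i\<in>I. \<Sum>k\<in>K. if shift_half N1 i = k then sM (?f i * ?g k) (T i) else 0)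
      - (\<Sum>i\<in>I. \<Sum>k\<in>K. if shift_half N2 k = i then sM (?f i * ?g k) (U k) else 0)
      + (\<Sum>i\<in>I. \<Sum>k\<in>K. if shift_half N1 i = k then sM (?f i * ?g k) (?c i) else 0)"
    unfolding 1 2 by (simp add: sum_subtractf[symmetric] sum.distrib[symmetric])
  also have "(\<Sum>i\<in>I. \<Sum>k\<in>K. if shift_half N1 i = k then sM (?f i * ?g k) (T i) else 0) =
      (\<Sum>i\<in>I. sM (?f i * ?g (shift_half N1 i)) (T i))"
    using fin by (intro sum.cong refl) (auto simp: sum.delta K_def I0_def)
  also have "\<dots> = mode (\<lambda>x. f x * g (x - of_int N1)) (a * b) (N1 + N2) w"
    unfolding T_def by (subst mode_superset[OF fin(1)])
      (auto simp: I_def I0_def T_def hval_shift_half of_rat_diff)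
  also have "(\<Sum>i\<in>I. \<Sum>k\<in>K. if shift_half N2 k = i then sM (?f i * ?g k) (U k) else 0) =
      (\<Sum>k\<in>K. \<Sum>i\<in>I. if shift_half N2 k = i then sM (?f i * ?g k) (U k) else 0)"
    by (rule sum.swap)
  also have "\<dots> = (\<Sum>k\<in>K. sM (?f (shift_half N2 k) * ?g k) (U k))"
    using fin by (intro sum.cong refl) (auto simp: sum.delta I_def K0_def)
  also have "\<dots> = mode (\<lambda>x. f (x - of_int N2) * g x) (b * a) (N1 + N2) w"
    unfolding U_def by (subst mode_superset[OF fin(2)])
      (auto simp: K_def K0_def U_def hval_shift_half of_rat_diff)
  also have "(\<Sum>i\<in>I. \<Sum>k\<in>K. if shift_half N1 i = k then sM (?f i * ?g k) (?c i) else 0) =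
      (\<Sum>i\<in>I. sM (?f i * ?g (shift_half N1 i)) (?c i))"
    using fin by (intro sum.cong refl) (auto simp: sum.delta K_def I0_def)
  also have "\<dots> = (if N1 + N2 = 0
      then sM ((\<Sum>i\<in>I. f (cval i) * g (cval i - of_int N1) * window N1 i) * tr (a * b)) \<kappa>w else 0)"
    by (simp add: sum_distrib_right M.scale_sum_left hval_shift_half of_rat_diff mult.assoc)
  also have "(\<Sum>i\<in>I. f (cval i) * g (cval i - of_int N1) * window N1 i) =
      Sum_any (\<lambda>l. f (cval l) * g (cval l - of_int N1) * window N1 l)"
    by (rule Sum_any.expand_superset[symmetric]) (use fin in \<open>auto simp: I_def I0_def\<close>)
  finally show ?thesis
    by (simp only: \<kappa>w_def)
qed

lemma mode_linear:
  "mode f a N (v + w) = mode f a N v + mode f a N w"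
  "mode f a N (sM c w) = sM c (mode f a N w)"
  "mode f a N (\<rho> (central 1) w) = \<rho> (central 1) (mode f a N w)"
  "mode f (a + b) N w = mode f a N w + mode f b N w"
  "mode f (sA c a) N w = sM c (mode f a N w)"
proof -
  define supp where "supp a w = {i. \<rho> (elt a (i, int_minus_half N i)) w \<noteq> 0}" for a w
  define S where "S = supp a v \<union> supp a w \<union> supp b w"
  have S: "finite S" "supp a v \<subseteq> S" "supp a w \<subseteq> S" "supp b w \<subseteq> S"
    by (auto simp: S_def supp_def finite_mode_support)
  have eq: "mode f a' N w' = (\<Sum>i\<in>S. sM (f (cval i)) (\<rho> (elt a' (i, int_minus_half N i)) w'))"
    if "supp a' w' \<subseteq> S" for a' w'
    using that S(1) by (intro mode_superset) (auto simp: supp_def)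
  have [simp]: "sM c 0 = 0" for c by simp
  have sub: "supp a (v + w) \<subseteq> S" "supp a (sM c w) \<subseteq> S" "supp a (\<rho> (central 1) w) \<subseteq> S"
    "supp (a + b) w \<subseteq> S" "supp (sA c a) w \<subseteq> S"
    by (auto simp: S_def supp_def rho_add rho_scale rho_central_commute rho_add_left elt_add
        elt_scale rho_scale_left)
  show "mode f a N (v + w) = mode f a N v + mode f a N w"
    unfolding eq[OF sub(1)] eq[OF S(2)] eq[OF S(3)]
    by (simp add: rho_add M.scale_right_distrib sum.distrib)
  show "mode f a N (sM c w) = sM c (mode f a N w)"
    unfolding eq[OF sub(2)] eq[OF S(3)]
    by (simp add: rho_scale M.scale_sum_right mult.commute)
  show "mode f a N (\<rho> (central 1) w) = \<rho> (central 1) (mode f a N w)"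
    unfolding eq[OF sub(3)] eq[OF S(3)]
    by (simp add: rho_scale rho_sum rho_central_commute)
  show "mode f (a + b) N w = mode f a N w + mode f b N w"
    unfolding eq[OF sub(4)] eq[OF S(3)] eq[OF S(4)]
    by (simp add: elt_add rho_add_left M.scale_right_distrib sum.distrib)
  show "mode f (sA c a) N w = sM c (mode f a N w)"
    unfolding eq[OF sub(5)] eq[OF S(3)]
    by (simp add: elt_scale rho_scale_left M.scale_sum_right mult.commute)
qed

lemma mode_zero: "mode f a N 0 = 0"
  using mode_linear(1)[of f a N 0 0] by simp

lemma mode_sum_coeff:
  "(\<Sum>p\<in>P. sM (\<nu> p) (mode (f p) a N w)) = mode (\<lambda>x. \<Sum>p\<in>P. \<nu> p * f p x) a N w"
proof -
  let ?S = "{i. \<rho> (elt a (i, int_minus_half N i)) w \<noteq> 0}"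
  have eq: "mode g a N w = (\<Sum>i\<in>?S. sM (g (cval i)) (\<rho> (elt a (i, int_minus_half N i)) w))" for g
    by (rule mode_superset) (simp_all add: finite_mode_support)
  show ?thesis
    unfolding eq by (simp add: M.scale_sum_right M.scale_sum_left) (rule sum.swap)
qed

text \<open>
  The trace term is the normal ordering correction that \<open>Y\<^sup>\<iota>\<close> and \<open>\<sigma>\<close> have in common; it is present
  only in degree \<open>0\<close>.
\<close>
definition corrected_mode :: "(complex \<Rightarrow> complex) \<Rightarrow> complex \<Rightarrow> 'a \<Rightarrow> int \<Rightarrow> 'm \<Rightarrow> 'm"
  where "corrected_mode f c a N w =
    mode f a N w + (if N = 0 then sM (c * tr a) (\<rho> (central 1) w) else 0)"

lemma corrected_mode_linear:
  "corrected_mode f c a N (v + w) = corrected_mode f c a N v + corrected_mode f c a N w"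
  "corrected_mode f c a N (sM s w) = sM s (corrected_mode f c a N w)"
  "corrected_mode f c a N (\<rho> (central 1) w) = \<rho> (central 1) (corrected_mode f c a N w)"
  "corrected_mode f c (a + b) N w = corrected_mode f c a N w + corrected_mode f c b N w"
  "corrected_mode f c (sA s a) N w = sM s (corrected_mode f c a N w)"
  by (simp_all add: corrected_mode_def mode_linear rho_add rho_scale tr_add tr_scale
      M.scale_right_distrib M.scale_left_distrib distrib_left mult_ac)

lemma corrected_mode_zero: "corrected_mode f c 0 N w = 0" "corrected_mode f c a N 0 = 0"
  using corrected_mode_linear(4)[of f c 0 0 N w] corrected_mode_linear(1)[of f c a N 0 0] by simp_all

lemma corrected_mode_sum_coeff:
  "(\<Sum>p\<in>P. sM (\<nu> p) (corrected_mode (f p) (c p) a N w)) =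
   corrected_mode (\<lambda>x. \<Sum>p\<in>P. \<nu> p * f p x) (\<Sum>p\<in>P. \<nu> p * c p) a N w"
  by (simp add: corrected_mode_def M.scale_right_distrib sum.distrib mode_sum_coeff sum_distrib_right
      M.scale_sum_left mult.assoc)

text \<open>
  Central corrections do not contribute to the left-hand side, while on the right-hand side
  corrections \<open>c\<^sub>1\<close>, \<open>c\<^sub>2\<close> can be installed at will at the expense of the central term, because
  \<open>tr(ab) = tr(ba)\<close>.
\<close>
lemma corrected_mode_commutator:
  assumes "N1 + N2 = 0 \<Longrightarrow>
    Sum_any (\<lambda>l. f (cval l) * g (cval l - of_int N1) * window N1 l) = c1 - c2 + e"
  shows "corrected_mode f c a N1 (corrected_mode g d b N2 w) - corrected_mode g d b N2 (corrected_mode f c a N1 w) =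
    corrected_mode (\<lambda>x. f x * g (x - of_int N1)) c1 (a * b) (N1 + N2) w
    - corrected_mode (\<lambda>x. f (x - of_int N2) * g x) c2 (b * a) (N1 + N2) w
    + (if N1 + N2 = 0 then sM (e * tr (a * b)) (\<rho> (central 1) w) else 0)"
proof -
  have "corrected_mode f c a N1 (corrected_mode g d b N2 w) - corrected_mode g d b N2 (corrected_mode f c a N1 w) =
    mode f a N1 (mode g b N2 w) - mode g b N2 (mode f a N1 w)"
    by (simp add: corrected_mode_def mode_linear mode_zero rho_add rho_scale M.scale_right_distrib
        M.scale_left_commute algebra_simps)
  then show ?thesis
    unfolding mode_commutator using assms
    by (auto simp: corrected_mode_def tr_commute[of b a] M.scale_left_distrib M.scale_left_diff_distrib
        distrib_right left_diff_distrib)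
qed

text \<open>
  The form in which the commutator is used: the functions on the right are expanded in those
  that belong to the basis elements of the target algebra, and the constants follow the same
  expansion.
\<close>
lemma corrected_mode_commutator_expand:
  assumes f1: "\<And>x. f x * g (x - of_int N1) = (\<Sum>p\<in>P. \<nu> p * F p x)"
    and f2: "\<And>x. f (x - of_int N2) * g x = (\<Sum>q\<in>Q. \<mu> q * F' q x)"
    and cent: "N1 + N2 = 0 \<Longrightarrow>
      Sum_any (\<lambda>l. f (cval l) * g (cval l - of_int N1) * window N1 l) =
        (\<Sum>p\<in>P. \<nu> p * C p) - (\<Sum>q\<in>Q. \<mu> q * C' q) + e"
  shows "corrected_mode f c a N1 (corrected_mode g d b N2 w) - corrected_mode g d b N2 (corrected_mode f c a N1 w) =
    (\<Sum>p\<in>P. sM (\<nu> p) (corrected_mode (F p) (C p) (a * b) (N1 + N2) w))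
    - (\<Sum>q\<in>Q. sM (\<mu> q) (corrected_mode (F' q) (C' q) (b * a) (N1 + N2) w))
    + (if N1 + N2 = 0 then sM (e * tr (a * b)) (\<rho> (central 1) w) else 0)"
proof -
  have "corrected_mode f c a N1 (corrected_mode g d b N2 w) - corrected_mode g d b N2 (corrected_mode f c a N1 w) =
    corrected_mode (\<lambda>x. f x * g (x - of_int N1)) (\<Sum>p\<in>P. \<nu> p * C p) (a * b) (N1 + N2) w
    - corrected_mode (\<lambda>x. f (x - of_int N2) * g x) (\<Sum>q\<in>Q. \<mu> q * C' q) (b * a) (N1 + N2) w
    + (if N1 + N2 = 0 then sM (e * tr (a * b)) (\<rho> (central 1) w) else 0)"
    by (rule corrected_mode_commutator) (rule cent)
  then show ?thesis
    unfolding corrected_mode_sum_coeff f1 f2 .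
qed

end

section \<open>The fields of the conformal algebra\<close>

definition Ycoeff :: "complex \<Rightarrow> nat \<Rightarrow> nat \<Rightarrow> int \<Rightarrow> complex \<Rightarrow> complex"
  where "Ycoeff \<iota> r1 r2 N x =
    ((- x - \<iota> - 1/2) gchoose r1) * ((x - of_int N + \<iota> - 1/2) gchoose r2)"

context restricted_rep
begin

lemma Yiota_elt_eq_corrected_mode:
  "Yiota_elt sM tr \<iota> \<rho> a (r1, r2) n w =
   corrected_mode (Ycoeff \<iota> r1 r2 (- n - int r1 - int r2 - 1)) (Im_const \<iota> r1 r2) a
     (- n - int r1 - int r2 - 1) w"
proof -
  define N where "N = - n - int r1 - int r2 - 1"
  let ?S = "{i. \<rho> (elt a (i, int_minus_half N i)) w \<noteq> 0}"
  let ?h = "\<lambda>(i, j). if of_int n = - hval i - hval j - of_nat r1 - of_nat r2 - 1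
      then sM (((- cval i - \<iota> - 1/2) gchoose r1) * ((- cval j + \<iota> - 1/2) gchoose r2))
             (\<rho> (elt a (i, j)) w)
      else 0"
  have iff: "of_int n = - hval i - hval j - of_nat r1 - of_nat r2 - 1 \<longleftrightarrow> j = int_minus_half N i" for i j
    by (auto simp: N_def hval_int_minus_half hval_inject[symmetric])
  have "Sum_any ?h = (\<Sum>(i, j)\<in>(\<lambda>i. (i, int_minus_half N i)) ` ?S. ?h (i, j))"
    unfolding iff case_prod_beta prod.collapse
    by (rule Sum_any.expand_superset) (auto simp: finite_mode_support image_iff split: if_splits)
  also have "\<dots> = (\<Sum>i\<in>?S. ?h (i, int_minus_half N i))"
    by (subst sum.reindex) (auto simp: inj_on_def)
  also have "\<dots> = mode (Ycoeff \<iota> r1 r2 N) a N w"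
    unfolding mode_superset[OF finite_mode_support subset_refl]
    by (rule sum.cong) (auto simp: iff Ycoeff_def hval_int_minus_half of_rat_diff)
  finally show ?thesis
    by (simp add: Yiota_elt_def corrected_mode_def N_def)
qed

lemma Yiota_elt_linear:
  "Yiota_elt sM tr \<iota> \<rho> (a + b) p n w = Yiota_elt sM tr \<iota> \<rho> a p n w + Yiota_elt sM tr \<iota> \<rho> b p n w"
  "Yiota_elt sM tr \<iota> \<rho> (sA c a) p n w = sM c (Yiota_elt sM tr \<iota> \<rho> a p n w)"
  "Yiota_elt sM tr \<iota> \<rho> 0 p n w = 0"
  "Yiota_elt sM tr \<iota> \<rho> a p n (v + w) = Yiota_elt sM tr \<iota> \<rho> a p n v + Yiota_elt sM tr \<iota> \<rho> a p n w"
  "Yiota_elt sM tr \<iota> \<rho> a p n (sM c w) = sM c (Yiota_elt sM tr \<iota> \<rho> a p n w)"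
  "Yiota_elt sM tr \<iota> \<rho> a p n (\<rho> (central 1) w) = \<rho> (central 1) (Yiota_elt sM tr \<iota> \<rho> a p n w)"
  by (cases p; simp add: Yiota_elt_eq_corrected_mode corrected_mode_linear corrected_mode_zero)+

text \<open>
  \<open>gchoose_product_expand\<close> gives both expansions, for \<open>ba\<close> with the roles of the two variables
  exchanged. The constants attached to the two expansions are the values at \<open>-\<iota>\<close> of the
  polynomials \<open>G\<close> and \<open>G'\<close> to which \<open>central_window_sum\<close> applies.
\<close>
lemma Yiota_elt_commutator:
  fixes m1 m2 n1 n2 :: nat and k1 k2 :: int
  defines "c1 \<equiv> ((- of_nat n1 - 1) gchoose m2 :: complex)"
    and "c2 \<equiv> ((- of_nat n2 - 1) gchoose m1 :: complex)"
    and "K \<equiv> - k1 - 1"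
  shows "Yiota_elt sM tr \<iota> \<rho> a (m1, m2) k1 (Yiota_elt sM tr \<iota> \<rho> b (n1, n2) k2 w)
      - Yiota_elt sM tr \<iota> \<rho> b (n1, n2) k2 (Yiota_elt sM tr \<iota> \<rho> a (m1, m2) k1 w) =
    (\<Sum>p = 0..m1 + m2 + n1. sM (c1 * of_nat (p choose m1) * (of_int K gchoose (m1 + m2 + n1 - p)))
      (Yiota_elt sM tr \<iota> \<rho> (a * b) (p, n2) (k2 - K + int (m1 + m2 + n1 - p)) w))
    - (\<Sum>q = 0..m1 + m2 + n2. sM (c2 * of_nat (q choose m2) * (of_int K gchoose (m1 + m2 + n2 - q)))
      (Yiota_elt sM tr \<iota> \<rho> (b * a) (n1, q) (k2 - K + int (m1 + m2 + n2 - q)) w))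
    + (if k2 - K + int (m1 + m2 + n1 + n2 + 1) = 0
       then sM (c1 * c2 * (of_int K gchoose (m1 + m2 + n1 + n2 + 1)) * tr (a * b))
         (\<rho> (central 1) w) else 0)"
proof -
  define N1 where "N1 = - k1 - int m1 - int m2 - 1"
  define N2 where "N2 = - k2 - int n1 - int n2 - 1"
  define N where "N = N1 + N2"
  define \<nu> where "\<nu> p = c1 * of_nat (p choose m1) * (of_int K gchoose (m1 + m2 + n1 - p))" for p
  define \<mu> where "\<mu> q = c2 * of_nat (q choose m2) * (of_int K gchoose (m1 + m2 + n2 - q))" for q
  have K: "of_int N1 + of_nat m1 + of_nat m2 = (of_int K :: complex)"
    by (simp add: N1_def K_def)
  have expand1: "(X gchoose m1) * ((- of_int N1 - 1 - X) gchoose m2) * ((X + of_int N1) gchoose n1) =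
      (\<Sum>p = 0..m1 + m2 + n1. \<nu> p * (X gchoose p))" for X
    unfolding gchoose_product_expand K by (simp add: \<nu>_def c1_def sum_distrib_left mult.assoc)
  have expand2: "(X gchoose m2) * ((- of_int N1 - 1 - X) gchoose m1) * ((X + of_int N1) gchoose n2) =
      (\<Sum>q = 0..m1 + m2 + n2. \<mu> q * (X gchoose q))" for X
    using gchoose_product_expand[of X m2 "of_int N1" m1 n2] K
    by (simp add: \<mu>_def c2_def sum_distrib_left mult.assoc add_ac)
  have e1: "- (k2 - K + int (m1 + m2 + n1 - p)) - int p - int n2 - 1 = N" if "p \<in> {0..m1 + m2 + n1}" for p
    using that by (simp add: N_def N1_def N2_def K_def)
  have e2: "- (k2 - K + int (m1 + m2 + n2 - q)) - int n1 - int q - 1 = N" if "q \<in> {0..m1 + m2 + n2}" for q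
    using that by (simp add: N_def N1_def N2_def K_def)
  have e3: "k2 - K + int (m1 + m2 + n1 + n2 + 1) = 0 \<longleftrightarrow> N = 0"
    by (auto simp: N_def N1_def N2_def K_def)
  let ?f = "Ycoeff \<iota> m1 m2 N1" and ?g = "Ycoeff \<iota> n1 n2 N2"
  have "corrected_mode ?f (Im_const \<iota> m1 m2) a N1 (corrected_mode ?g (Im_const \<iota> n1 n2) b N2 w)
      - corrected_mode ?g (Im_const \<iota> n1 n2) b N2 (corrected_mode ?f (Im_const \<iota> m1 m2) a N1 w) =
    (\<Sum>p = 0..m1 + m2 + n1. sM (\<nu> p) (corrected_mode (Ycoeff \<iota> p n2 N) (Im_const \<iota> p n2) (a * b) N w))
    - (\<Sum>q = 0..m1 + m2 + n2. sM (\<mu> q) (corrected_mode (Ycoeff \<iota> n1 q N) (Im_const \<iota> n1 q) (b * a) N w))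
    + (if N = 0 then sM (c1 * c2 * (of_int K gchoose (m1 + m2 + n1 + n2 + 1)) * tr (a * b))
        (\<rho> (central 1) w) else 0)"
    unfolding N_def
  proof (rule corrected_mode_commutator_expand)
    fix x :: complex
    \<comment> \<open>\<open>X\<close> and \<open>Y\<close> are the upper arguments that belong to the two variables in total degree \<open>N\<close>.\<close>
    define X where "X = - x - \<iota> - 1/2"
    define Y where "Y = x - of_int N + \<iota> - 1/2"
    have "?f x * ?g (x - of_int N1) = (X gchoose m1) * ((- of_int N1 - 1 - X) gchoose m2) *
        ((X + of_int N1) gchoose n1) * (Y gchoose n2)"
      by (simp add: Ycoeff_def X_def Y_def N_def algebra_simps)
    also have "\<dots> = (\<Sum>p = 0..m1 + m2 + n1. \<nu> p * ((X gchoose p) * (Y gchoose n2)))"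
      unfolding expand1 by (simp add: sum_distrib_right mult.assoc)
    finally show "?f x * ?g (x - of_int N1) =
        (\<Sum>p = 0..m1 + m2 + n1. \<nu> p * Ycoeff \<iota> p n2 (N1 + N2) x)"
      by (simp add: Ycoeff_def X_def Y_def N_def)
    have "?f (x - of_int N2) * ?g x = ((Y gchoose m2) * ((- of_int N1 - 1 - Y) gchoose m1) *
        ((Y + of_int N1) gchoose n2)) * (X gchoose n1)"
      by (simp add: Ycoeff_def X_def Y_def N_def algebra_simps)
    also have "\<dots> = (\<Sum>q = 0..m1 + m2 + n2. \<mu> q * ((X gchoose n1) * (Y gchoose q)))"
      unfolding expand2 by (simp add: sum_distrib_left mult_ac)
    finally show "?f (x - of_int N2) * ?g x =
        (\<Sum>q = 0..m1 + m2 + n2. \<mu> q * Ycoeff \<iota> n1 q (N1 + N2) x)"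
      by (simp add: Ycoeff_def X_def Y_def N_def)
  next
    assume "N1 + N2 = 0"
    then have N2: "N2 = - N1"
      by simp
    define G where "G X = (\<Sum>p = 0..m1 + m2 + n1. \<nu> p * Im_const (- X) p n2)" for X
    define G' where "G' X = (\<Sum>q = 0..m1 + m2 + n2. \<mu> q * Im_const (- X) n1 q)" for X
    have G1: "G (X + 1) - G X = 1 * mode_product m1 m2 n1 n2 N1 X" for X
      unfolding G_def sum_subtractf[symmetric] right_diff_distrib[symmetric] Im_const_difference
        mode_product_def expand1 by (simp add: sum_distrib_right mult.assoc)
    have G'1: "G' (X + 1) - G' X = 1 * mode_product m1 m2 n1 n2 N1 (X - of_int N1)" for X
    proof -
      have "mode_product m1 m2 n1 n2 N1 (X - of_int N1) =
        ((-1 - X) gchoose m2) * ((- of_int N1 - 1 - (-1 - X)) gchoose m1) *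
        ((-1 - X + of_int N1) gchoose n2) * (X gchoose n1)"
        by (simp add: mode_product_def algebra_simps)
      then show ?thesis
        unfolding G'_def sum_subtractf[symmetric] right_diff_distrib[symmetric] Im_const_difference
          expand2 by (simp add: sum_distrib_left mult_ac)
    qed
    have "Sum_any (\<lambda>l. ?f (cval l) * ?g (cval l - of_int N1) * window N1 l) =
      G (- \<iota>) - G' (- \<iota>) + 1 * c1 * c2 *
        ((of_int N1 + of_nat m1 + of_nat m2) gchoose (m1 + m2 + n1 + n2 + 1))"
      unfolding c1_def c2_def
    proof (rule central_window_sum[where P = "\<lambda>x. ?f x * ?g (x - of_int N1)"])
      show "?f x * ?g (x - of_int N1) = 1 * mode_product m1 m2 n1 n2 N1 (- x - \<iota> - 1/2)" for x
        by (simp add: Ycoeff_def mode_product_def N2 algebra_simps)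
      show "polyfun G" "polyfun G'"
        unfolding G_def G'_def by (intro polyfun_intros polyfun_Im_const)+
      show "G 0 = 0" "G' 0 = 0"
        unfolding G_def G'_def by (simp_all add: Im_const_zero)
    qed (use G1 G'1 in simp_all)
    then show "Sum_any (\<lambda>l. ?f (cval l) * ?g (cval l - of_int N1) * window N1 l) =
      (\<Sum>p = 0..m1 + m2 + n1. \<nu> p * Im_const \<iota> p n2)
      - (\<Sum>q = 0..m1 + m2 + n2. \<mu> q * Im_const \<iota> n1 q)
      + c1 * c2 * (of_int K gchoose (m1 + m2 + n1 + n2 + 1))"
      by (simp add: G_def G'_def K)
  qed
  then show ?thesis
    unfolding Yiota_elt_eq_corrected_mode e3 N1_def[symmetric] N2_def[symmetric]
    by (simp only: e1 e2 \<nu>_def \<mu>_def cong: sum.cong)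
qed

end

lemma Yplus_elt:
  assumes "tr 0 = 0" and "\<And>c. sA c 0 = 0"
  shows "Yplus sA tr (elt a (m1, m2)) n (elt b (n1, n2)) =
      (\<Sum>p = 0..m1 + m2 + n1.
         if n = int p - int m1 - int m2 - int n1 - 1
         then elt (sA (((- of_nat n1 - 1) gchoose m2) * of_nat (p choose m1)) (a * b)) (p, n2)
         else 0)
    - (\<Sum>q = 0..m1 + m2 + n2.
         if n = int q - int m1 - int m2 - int n2 - 1
         then elt (sA (((- of_nat n2 - 1) gchoose m1) * of_nat (q choose m2)) (b * a)) (n1, q)
         else 0)
    + (if n = - int m1 - int m2 - int n1 - int n2 - 2
       then central (((- of_nat n1 - 1) gchoose m2) * ((- of_nat n2 - 1) gchoose m1) * tr (a * b))
       else 0)"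
  unfolding Yplus_def by (subst bilin_ext_elt) (simp_all add: assms cong: if_cong)

lemma sum_if_single:
  assumes "finite A" "x \<in> A"
  shows "(\<Sum>q\<in>A. if q = x then F q else 0) = (F x :: 'b::comm_monoid_add)"
  using assms by (simp add: sum.delta)

context restricted_rep
begin

lemma Yiota_on_elt: "Yiota sM tr \<iota> \<rho> (elt a p) n w = Yiota_elt sM tr \<iota> \<rho> a p n w"
  by (auto simp: Yiota_def elt_def Yiota_elt_linear(3))

lemma Yiota_central:
  "Yiota sM tr \<iota> \<rho> (central c) n w = (if n = 0 then sM c (\<rho> (central 1) w) else 0)"
  by (simp add: Yiota_def central_def)

lemma Yiota_add:
  "Yiota sM tr \<iota> \<rho> (X + Y) n w = Yiota sM tr \<iota> \<rho> X n w + Yiota sM tr \<iota> \<rho> Y n w"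
proof -
  have "(\<Sum>p\<in>Poly_Mapping.keys (fst X + fst Y).
      Yiota_elt sM tr \<iota> \<rho> (Poly_Mapping.lookup (fst X + fst Y) p) p n w) =
    (\<Sum>p\<in>Poly_Mapping.keys (fst X). Yiota_elt sM tr \<iota> \<rho> (Poly_Mapping.lookup (fst X) p) p n w)
    + (\<Sum>p\<in>Poly_Mapping.keys (fst Y). Yiota_elt sM tr \<iota> \<rho> (Poly_Mapping.lookup (fst Y) p) p n w)"
    by (rule setsum_keys_plus_distrib) (simp_all add: Yiota_elt_linear)
  then show ?thesis
    by (simp add: Yiota_def M.scale_left_distrib)
qed

lemma Yiota_zero: "Yiota sM tr \<iota> \<rho> 0 n w = 0"
  using Yiota_add[of \<iota> 0 0 n w] by simp

lemma Yiota_diff: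
  "Yiota sM tr \<iota> \<rho> (X - Y) n w = Yiota sM tr \<iota> \<rho> X n w - Yiota sM tr \<iota> \<rho> Y n w"
  using Yiota_add[of \<iota> "X - Y" Y n w] by simp

lemma Yiota_sum:
  "Yiota sM tr \<iota> \<rho> (\<Sum>p\<in>P. X p) n w = (\<Sum>p\<in>P. Yiota sM tr \<iota> \<rho> (X p) n w)"
  by (induction P rule: infinite_finite_induct) (simp_all add: Yiota_zero Yiota_add)

text \<open>
  In each sum of \<open>Y\<^sup>+\<close> the power of \<open>z\<^sub>0\<close> determines the summation index, so summing over the powers
  of \<open>z\<^sub>0\<close> leaves the expression of \<open>Yiota_elt_commutator\<close>.  The bound on \<open>Q\<close> says that all powers of
  \<open>z\<^sub>0\<^bsup>-1\<^esup>\<close> in \<open>Y\<^sup>+(a[m\<^sub>1, m\<^sub>2], z\<^sub>0) b[n\<^sub>1, n\<^sub>2]\<close> are reached.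
\<close>
lemma Yiota_elt_commutator_Yplus:
  assumes Q: "m1 + m2 + n1 + n2 + 1 \<le> Q"
  shows "Yiota_elt sM tr \<iota> \<rho> a (m1, m2) k1 (Yiota_elt sM tr \<iota> \<rho> b (n1, n2) k2 w)
      - Yiota_elt sM tr \<iota> \<rho> b (n1, n2) k2 (Yiota_elt sM tr \<iota> \<rho> a (m1, m2) k1 w) =
    (\<Sum>q\<le>Q. sM (of_int (- k1 - 1) gchoose q)
      (Yiota sM tr \<iota> \<rho> (Yplus sA tr (elt a (m1, m2)) (- 1 - int q) (elt b (n1, n2)))
        (k2 + k1 + 1 + int q) w))"
proof -
  let ?c1 = "(- of_nat n1 - 1) gchoose m2 :: complex"
  let ?c2 = "(- of_nat n2 - 1) gchoose m1 :: complex"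
  let ?k = "\<lambda>q. of_int (- k1 - 1) gchoose q :: complex"
  let ?e = "\<lambda>q. k2 + k1 + 1 + int q"
  let ?Y = "\<lambda>a p n. Yiota_elt sM tr \<iota> \<rho> a p n w"
  have shift: "k2 - (- k1 - 1) + int x = ?e x" for x
    by simp
  have idx: "- 1 - int q = int p - int x - int y - int z - 1 \<longleftrightarrow> q = x + y + z - p"
    if "p \<in> {0..x + y + z}" for p q x y z
    using that by auto
  have idx3: "- 1 - int q = - int m1 - int m2 - int n1 - int n2 - 2 \<longleftrightarrow> q = m1 + m2 + n1 + n2 + 1" for q
    by auto
  have "Yiota sM tr \<iota> \<rho> (Yplus sA tr (elt a (m1, m2)) (- 1 - int q) (elt b (n1, n2))) (?e q) w =
      (\<Sum>p = 0..m1 + m2 + n1. if q = m1 + m2 + n1 - p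
        then sM (?c1 * of_nat (p choose m1)) (?Y (a * b) (p, n2) (?e q)) else 0)
    - (\<Sum>p = 0..m1 + m2 + n2. if q = m1 + m2 + n2 - p
        then sM (?c2 * of_nat (p choose m2)) (?Y (b * a) (n1, p) (?e q)) else 0)
    + (if q = m1 + m2 + n1 + n2 + 1 then if ?e q = 0
        then sM (?c1 * ?c2 * tr (a * b)) (\<rho> (central 1) w) else 0 else 0)" for q
    unfolding Yplus_elt[where tr = tr and sA = sA, OF tr_zero scale_zero_right] Yiota_add Yiota_diff Yiota_sum idx3
    by (intro arg_cong2[where f = "(+)"] arg_cong2[where f = "(-)"] sum.cong refl)
      (auto simp: idx Yiota_on_elt Yiota_central Yiota_zero Yiota_elt_linear)
  then have "(\<Sum>q\<le>Q. sM (?k q) (Yiota sM tr \<iota> \<rho>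
        (Yplus sA tr (elt a (m1, m2)) (- 1 - int q) (elt b (n1, n2))) (?e q) w)) =
      (\<Sum>q\<le>Q. \<Sum>p = 0..m1 + m2 + n1. if q = m1 + m2 + n1 - p
        then sM (?c1 * of_nat (p choose m1) * ?k q) (?Y (a * b) (p, n2) (?e q)) else 0)
    - (\<Sum>q\<le>Q. \<Sum>p = 0..m1 + m2 + n2. if q = m1 + m2 + n2 - p
        then sM (?c2 * of_nat (p choose m2) * ?k q) (?Y (b * a) (n1, p) (?e q)) else 0)
    + (\<Sum>q\<le>Q. if q = m1 + m2 + n1 + n2 + 1 then if ?e q = 0
        then sM (?c1 * ?c2 * ?k q * tr (a * b)) (\<rho> (central 1) w) else 0 else 0)"
    by (simp add: M.scale_right_distrib M.scale_right_diff_distrib M.scale_sum_right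
        sum.distrib sum_subtractf if_distrib[of "sM _"] mult_ac cong: if_cong)
  also have "(\<Sum>q\<le>Q. \<Sum>p = 0..m1 + m2 + n1. if q = m1 + m2 + n1 - p
        then sM (?c1 * of_nat (p choose m1) * ?k q) (?Y (a * b) (p, n2) (?e q)) else 0) =
      (\<Sum>p = 0..m1 + m2 + n1. sM (?c1 * of_nat (p choose m1) * ?k (m1 + m2 + n1 - p))
        (?Y (a * b) (p, n2) (?e (m1 + m2 + n1 - p))))"
    by (subst sum.swap, intro sum.cong refl sum_if_single) (use Q in auto)
  also have "(\<Sum>q\<le>Q. \<Sum>p = 0..m1 + m2 + n2. if q = m1 + m2 + n2 - p
        then sM (?c2 * of_nat (p choose m2) * ?k q) (?Y (b * a) (n1, p) (?e q)) else 0) =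
      (\<Sum>p = 0..m1 + m2 + n2. sM (?c2 * of_nat (p choose m2) * ?k (m1 + m2 + n2 - p))
        (?Y (b * a) (n1, p) (?e (m1 + m2 + n2 - p))))"
    by (subst sum.swap, intro sum.cong refl sum_if_single) (use Q in auto)
  also have "(\<Sum>q\<le>Q. if q = m1 + m2 + n1 + n2 + 1 then if ?e q = 0
        then sM (?c1 * ?c2 * ?k q * tr (a * b)) (\<rho> (central 1) w) else 0 else 0) =
      (if ?e (m1 + m2 + n1 + n2 + 1) = 0
       then sM (?c1 * ?c2 * ?k (m1 + m2 + n1 + n2 + 1) * tr (a * b)) (\<rho> (central 1) w) else 0)"
    by (rule sum_if_single) (use Q in auto)
  finally show ?thesis
    unfolding Yiota_elt_commutator shift by (rule sym)
qed

lemma Yplus_expand: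
  "Yplus sA tr u n v = (\<Sum>p\<in>Poly_Mapping.keys (fst u). \<Sum>q\<in>Poly_Mapping.keys (fst v).
    Yplus sA tr (elt (Poly_Mapping.lookup (fst u) p) p) n (elt (Poly_Mapping.lookup (fst v) q) q))"
  unfolding Yplus_def by (rule bilin_ext_expand) (auto cong: if_cong)

lemma Yplus_elt_truncate:
  assumes "fst p + snd p + fst q + snd q + 1 < j"
  shows "Yplus sA tr (elt a p) (- 1 - int j) (elt b q) = 0"
proof -
  obtain m1 m2 n1 n2 where pq: "p = (m1, m2)" "q = (n1, n2)"
    by (metis prod.collapse)
  show ?thesis
    using assms unfolding pq Yplus_elt[where tr = tr and sA = sA, OF tr_zero scale_zero_right] 
    by (auto intro!: sum.neutral)
qed

text \<open>
  In the residue the power of \<open>z\<^sub>1\<close> fixes the exponent \<open>-k\<^sub>1 - 1\<close> of \<open>z\<^sub>2 + z\<^sub>0\<close>, so one index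
  remains, the power \<open>q\<close> of \<open>z\<^sub>0\<close>, and it is bounded since \<open>Y\<^sup>+\<close> has a pole of finite order.
\<close>
lemma series_mult_delta:
  assumes Q: "\<And>q. Q < q \<Longrightarrow> Yplus sA tr u (- 1 - int q) v = 0"
  shows "Res0 (series_mult sM delta_kernel (Yiota_Yplus sA sM tr \<iota> \<rho> u v w)) k1 k2 =
    (\<Sum>q\<le>Q. sM (of_int (- k1 - 1) gchoose q)
      (Yiota sM tr \<iota> \<rho> (Yplus sA tr u (- 1 - int q) v) (k2 + k1 + 1 + int q) w))"
proof -
  let ?h = "\<lambda>(p0, p1, p2). sM (delta_kernel p0 p1 p2)
    (Yiota_Yplus sA sM tr \<iota> \<rho> u v w (- 1 - p0) (k1 - p1) (k2 - p2))"
  let ?i = "\<lambda>q. (int q, k1, - k1 - 1 - int q)"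
  have "{x. ?h x \<noteq> 0} \<subseteq> ?i ` {..Q}"
  proof
    fix x
    assume "x \<in> {x. ?h x \<noteq> 0}"
    moreover obtain p0 p1 p2 where x: "x = (p0, p1, p2)"
      by (cases x)
    ultimately have "delta_kernel p0 p1 p2 \<noteq> 0"
      "Yiota_Yplus sA sM tr \<iota> \<rho> u v w (- 1 - p0) (k1 - p1) (k2 - p2) \<noteq> 0"
      by auto
    then have p: "0 \<le> p0" "p2 + p0 = - p1 - 1" "p1 = k1" "Yplus sA tr u (- 1 - p0) v \<noteq> 0"
      by (auto simp: delta_kernel_def binom_expand_def Yiota_Yplus_def Yiota_zero split: if_splits)
    moreover have "nat p0 \<le> Q"
      using Q[of "nat p0"] p(1,4) by (cases "nat p0 \<le> Q") auto
    ultimately show "x \<in> ?i ` {..Q}"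
      unfolding x by (intro image_eqI[of _ _ "nat p0"]) auto
  qed
  then have "Sum_any ?h = (\<Sum>x\<in>?i ` {..Q}. ?h x)"
    by (intro Sum_any.expand_superset) auto
  also have "\<dots> = (\<Sum>q\<le>Q. ?h (?i q))"
    by (subst sum.reindex) (auto simp: inj_on_def)
  finally show ?thesis
    by (simp add: Res0_def series_mult_def delta_kernel_def formal_delta_def binom_expand_def
        Yiota_Yplus_def algebra_simps)
qed

text \<open>
  Both sides are sums over the terms of \<open>u\<close> and \<open>v\<close>, to which central terms contribute nothing.  The
  number of terms of the residue depends on \<open>u\<close> and \<open>v\<close>; a common bound \<open>Q\<close> makes the summations
  interchangeable.
\<close>
lemma Yiota_commutator:
  "Yiota sM tr \<iota> \<rho> u k1 (Yiota sM tr \<iota> \<rho> v k2 w) - Yiota sM tr \<iota> \<rho> v k2 (Yiota sM tr \<iota> \<rho> u k1 w)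
    = Res0 (series_mult sM delta_kernel (Yiota_Yplus sA sM tr \<iota> \<rho> u v w)) k1 k2"
proof -
  let ?ku = "Poly_Mapping.keys (fst u)" and ?kv = "Poly_Mapping.keys (fst v)"
  let ?u = "Poly_Mapping.lookup (fst u)" and ?v = "Poly_Mapping.lookup (fst v)"
  let ?Y = "Yiota_elt sM tr \<iota> \<rho>"
  \<comment> \<open>On basis elements with exponents \<open>p\<close> and \<open>q\<close> the pole of \<open>Y\<^sup>+\<close> has order at most \<open>d p q + 1\<close>.\<close>
  define d where "d p q = fst p + snd p + fst q + snd q + 1" for p q :: "nat \<times> nat"
  define Q where "Q = (\<Sum>p\<in>?ku. \<Sum>q\<in>?kv. d p q)"
  have d_le: "d p q \<le> Q" if "p \<in> ?ku" "q \<in> ?kv" for p q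
  proof -
    have "d p q \<le> (\<Sum>q\<in>?kv. d p q)"
      using that by (intro member_le_sum) auto
    also have "\<dots> \<le> Q"
      unfolding Q_def using that by (intro member_le_sum) auto
    finally show ?thesis .
  qed
  have vanish: "Yplus sA tr u (- 1 - int j) v = 0" if "Q < j" for j
  proof -
    have "d p q < j" if "p \<in> ?ku" "q \<in> ?kv" for p q
      using d_le[OF that] \<open>Q < j\<close> by simp
    then show ?thesis
      by (subst Yplus_expand) (simp add: Yplus_elt_truncate d_def)
  qed
  have add0: "?Y a p n 0 = 0" for a p n
    using Yiota_elt_linear(4)[of \<iota> a p n 0 0] by simp
  have sum_right: "?Y a p n (\<Sum>i\<in>I. h i) = (\<Sum>i\<in>I. ?Y a p n (h i))" for a p n h and I :: "(nat \<times> nat) set"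
    by (induction I rule: infinite_finite_induct) (simp_all add: add0 Yiota_elt_linear)
  let ?S = "\<lambda>n x w. if n = 0 then sM x (\<rho> (central 1) w) else 0"
  have YS: "Yiota sM tr \<iota> \<rho> z n w = (\<Sum>p\<in>Poly_Mapping.keys (fst z).
      ?Y (Poly_Mapping.lookup (fst z) p) p n w) + ?S n (snd z) w" for z n w
    by (simp add: Yiota_def)
  have S_add: "?S n x (v + w) = ?S n x v + ?S n x w" for n x v w
    by (simp add: rho_add M.scale_right_distrib)
  have S_sum: "?S n x (\<Sum>i\<in>I. h i) = (\<Sum>i\<in>I. ?S n x (h i))" for n x h and I :: "(nat \<times> nat) set"
    by (simp add: rho_sum M.scale_sum_right)
  have S_comm: "?Y a p n (?S k x w) = ?S k x (?Y a p n w)" for a p n k x w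
    by (simp add: Yiota_elt_linear add0)
  have S_S: "?S n x (?S k y w) = ?S k y (?S n x w)" for n x k y w
    by (simp add: rho_scale M.scale_left_commute)
  have "Yiota sM tr \<iota> \<rho> u k1 (Yiota sM tr \<iota> \<rho> v k2 w) - Yiota sM tr \<iota> \<rho> v k2 (Yiota sM tr \<iota> \<rho> u k1 w)
    = (\<Sum>p\<in>?ku. \<Sum>q\<in>?kv. ?Y (?u p) p k1 (?Y (?v q) q k2 w))
      - (\<Sum>q\<in>?kv. \<Sum>p\<in>?ku. ?Y (?v q) q k2 (?Y (?u p) p k1 w))"
    unfolding YS Yiota_elt_linear(4) sum_right S_add S_sum S_comm sum.distrib
    using S_S[of k1 "snd u" k2 "snd v" w] by (simp only: algebra_simps) 
  also have "\<dots> = (\<Sum>p\<in>?ku. \<Sum>q\<in>?kv. ?Y (?u p) p k1 (?Y (?v q) q k2 w)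
      - ?Y (?v q) q k2 (?Y (?u p) p k1 w))"
    by (subst (2) sum.swap) (simp add: sum_subtractf)
  also have "\<dots> = (\<Sum>p\<in>?ku. \<Sum>q\<in>?kv. \<Sum>j\<le>Q. sM (of_int (- k1 - 1) gchoose j)
      (Yiota sM tr \<iota> \<rho> (Yplus sA tr (elt (?u p) p) (- 1 - int j) (elt (?v q) q))
        (k2 + k1 + 1 + int j) w))"
  proof (intro sum.cong refl)
    fix p q assume "p \<in> ?ku" "q \<in> ?kv"
    from d_le[OF this] have le: "fst p + snd p + fst q + snd q + 1 \<le> Q"
      by (simp add: d_def)
    show "?Y (?u p) p k1 (?Y (?v q) q k2 w) - ?Y (?v q) q k2 (?Y (?u p) p k1 w) =
      (\<Sum>j\<le>Q. sM (of_int (- k1 - 1) gchoose j)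
      (Yiota sM tr \<iota> \<rho> (Yplus sA tr (elt (?u p) p) (- 1 - int j) (elt (?v q) q))
        (k2 + k1 + 1 + int j) w))"
      using Yiota_elt_commutator_Yplus[OF le, of \<iota> "?u p" k1 "?v q" k2 w] by simp
  qed
  also have "\<dots> = (\<Sum>j\<le>Q. sM (of_int (- k1 - 1) gchoose j)
      (Yiota sM tr \<iota> \<rho> (Yplus sA tr u (- 1 - int j) v) (k2 + k1 + 1 + int j) w))"
    unfolding Yplus_expand[of u _ v] Yiota_sum M.scale_sum_right
    by (rule trans[OF sum.cong[OF refl sum.swap] sum.swap])
  also have "\<dots> = Res0 (series_mult sM delta_kernel (Yiota_Yplus sA sM tr \<iota> \<rho> u v w)) k1 k2"
    by (rule series_mult_delta[symmetric]) (rule vanish)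
  finally show ?thesis .
qed

end

section \<open>The representation of the Lie algebra of differential operators\<close>

text \<open>
  The Leibniz rule in disguise: \<open>t\<^sup>\<mu> \<partial>\<^bsup>j\<^sub>2\<^esup>\<close> followed by \<open>\<partial>\<^bsup>j\<^sub>1\<^esup>\<close> multiplies \<open>t\<^sup>Z\<close> by the left-hand
  side (and shifts the exponent), while the right-hand side is the effect of the normally
  ordered product.
\<close>
lemma ffact_product_expand:
  "ffact (Z + \<mu> - of_nat j2) j1 * ffact Z j2 =
    (\<Sum>k\<le>j1. of_nat (j1 choose k) * ffact \<mu> k * ffact Z (j1 + j2 - k))"
proof -
  have "Z + \<mu> - of_nat j2 = \<mu> + (Z - of_nat j2)"
    by simp
  have "ffact (Z + \<mu> - of_nat j2) j1 * ffact Z j2 =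
    (\<Sum>k\<le>j1. of_nat (j1 choose k) * ffact \<mu> k * (ffact Z j2 * ffact (Z - of_nat j2) (j1 - k)))"
    unfolding \<open>Z + \<mu> - of_nat j2 = \<mu> + (Z - of_nat j2)\<close> ffact_Vandermonde
    by (simp add: sum_distrib_left mult_ac)
  also have "\<dots> = (\<Sum>k\<le>j1. of_nat (j1 choose k) * ffact \<mu> k * ffact Z (j1 + j2 - k))"
    by (rule sum.cong) (auto simp: ffact_add[symmetric] add.commute)
  finally show ?thesis .
qed

context trace_algebra
begin

lemma tensor_diffop_sum:
  "tensor_diffop sA a (\<Sum>k\<in>K. Poly_Mapping.single (h k) (d k)) = (\<Sum>k\<in>K. elt (sA (d k) a) (h k))"
proof -
  have lookup: "Poly_Mapping.lookup (Poly_Mapping.map (\<lambda>c. sA c a) D) p = sA (Poly_Mapping.lookup D p) a"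
    for D :: diffop and p
    by (simp add: Poly_Mapping.map.rep_eq when_def)
  have add: "tensor_diffop sA a (D + E) = tensor_diffop sA a D + tensor_diffop sA a E" for D E
    by (simp add: tensor_diffop_def prod_eq_iff poly_mapping_eq_iff fun_eq_iff lookup lookup_add
        scale_left_distrib)
  have zero: "tensor_diffop sA a 0 = 0"
    using add[of 0 0] by simp
  have single: "tensor_diffop sA a (Poly_Mapping.single p c) = elt (sA c a) p" for p c
    by (simp add: tensor_diffop_def elt_def poly_mapping_eq_iff fun_eq_iff lookup lookup_single when_def)
  show ?thesis
    by (induction K rule: infinite_finite_induct) (simp_all add: zero add single)
qed

lemma hat_bracket_elt:
  "hat_bracket sA tr (elt a (i1, j1)) (elt b (i2, j2)) =
    (\<Sum>k\<le>j1. elt (sA (of_nat (j1 choose k) * ffact (of_int i2) k) (a * b))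
      (i1 + i2 - int k, j1 + j2 - k))
    - (\<Sum>k\<le>j2. elt (sA (of_nat (j2 choose k) * ffact (of_int i1) k) (b * a))
      (i2 + i1 - int k, j2 + j1 - k))
    + central ((-1) ^ j1 * (if i1 + i2 = int j1 + int j2 then 1 else 0)
        * fact j1 * fact j2 * (of_int i1 gchoose (j1 + j2 + 1)) * tr (a * b))"
proof -
  have "tensor_diffop sA 0 D = 0" for D
    by (simp add: tensor_diffop_def prod_eq_iff poly_mapping_eq_iff fun_eq_iff
        Poly_Mapping.map.rep_eq when_def)
  then show ?thesis
    unfolding hat_bracket_def
    by (subst bilin_ext_elt) (simp_all only: case_prod_conv mult_zero_left mult_zero_right tr_zero
        sum.neutral_const scale_zero_right elt_zero diff_self add_0_left central_zero
        diffop_monom_times.simps tensor_diffop_sum)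
qed

lemma hat_bracket_expand:
  "hat_bracket sA tr u v = (\<Sum>p\<in>Poly_Mapping.keys (fst u). \<Sum>q\<in>Poly_Mapping.keys (fst v).
    hat_bracket sA tr (elt (Poly_Mapping.lookup (fst u) p) p) (elt (Poly_Mapping.lookup (fst v) q) q))"
proof -
  have "tensor_diffop sA 0 D = 0" for D
    by (simp add: tensor_diffop_def prod_eq_iff poly_mapping_eq_iff fun_eq_iff
        Poly_Mapping.map.rep_eq when_def)
  then show ?thesis
    unfolding hat_bracket_def by (intro bilin_ext_expand) (auto split: prod.splits)
qed

end

context restricted_rep
begin

text \<open>
  The mode is indexed by the first half-integer \<open>x\<close>, so \<open>x - (m - r)\<close> is the value \<open>-l\<close> for the second
  one.
\<close>
definition sigma_elt :: "complex \<Rightarrow> 'a \<Rightarrow> int \<times> nat \<Rightarrow> 'm \<Rightarrow> 'm"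
  where "sigma_elt \<iota> a = (\<lambda>(m, r). corrected_mode (\<lambda>x. ffact (x - of_int (m - int r) + \<iota> - 1/2) r)
    (fact r * Im_const \<iota> 0 r) a (m - int r))"

definition sigma :: "complex \<Rightarrow> (int \<times> nat, 'a) cext \<Rightarrow> 'm \<Rightarrow> 'm"
  where "sigma \<iota> X w = (\<Sum>p\<in>Poly_Mapping.keys (fst X). sigma_elt \<iota> (Poly_Mapping.lookup (fst X) p) p w)
    + sM (snd X) (\<rho> (central 1) w)"

lemma sigma_elt_linear:
  "sigma_elt \<iota> a p (v + w) = sigma_elt \<iota> a p v + sigma_elt \<iota> a p w"
  "sigma_elt \<iota> a p (sM s w) = sM s (sigma_elt \<iota> a p w)"
  "sigma_elt \<iota> a p (\<rho> (central 1) w) = \<rho> (central 1) (sigma_elt \<iota> a p w)"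
  "sigma_elt \<iota> (a + b) p w = sigma_elt \<iota> a p w + sigma_elt \<iota> b p w"
  "sigma_elt \<iota> (sA s a) p w = sM s (sigma_elt \<iota> a p w)"
  "sigma_elt \<iota> 0 p w = 0"
  "sigma_elt \<iota> a p 0 = 0"
  by (cases p; simp add: sigma_elt_def corrected_mode_linear corrected_mode_zero)+

lemma sigma_elt_explicit:
  "sigma_elt \<iota> a (m, r) w = Sum_any (\<lambda>l. sM (ffact (- cval l + \<iota> - 1/2) r)
      (\<rho> (elt a (int_minus_half (m - int r) l, l)) w))
    + sM (fact r * (if int r = m then 1 else 0) * Im_const \<iota> 0 r * tr a) (\<rho> (central 1) w)"
proof -
  define N where "N = m - int r"
  have inv: "int_minus_half N (int_minus_half N i) = i" for i
    by (simp add: hval_inject[symmetric] hval_int_minus_half)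
  have bij: "bij (int_minus_half N)"
    by (rule o_bij[of "int_minus_half N"]) (auto simp: inv fun_eq_iff)
  have "mode (\<lambda>x. ffact (x - of_int N + \<iota> - 1/2) r) a N w =
    Sum_any (\<lambda>l. sM (ffact (- cval l + \<iota> - 1/2) r) (\<rho> (elt a (int_minus_half N l, l)) w))"
    unfolding mode_def
    by (rule Sum_any.reindex_cong[of "int_minus_half N"])
      (simp_all add: bij fun_eq_iff inv hval_int_minus_half of_rat_diff)
  then show ?thesis
    by (simp add: sigma_elt_def corrected_mode_def N_def)
qed

text \<open>
  \<open>ffact_product_expand\<close> with \<open>Z = -l + \<iota> - 1/2\<close> gives both expansions.  For the central term, the
  falling factorials are \<open>j\<^sub>1! j\<^sub>2!\<close> times \<open>mode_product\<close> with \<open>m\<^sub>1 = n\<^sub>1 = 0\<close>, and \<open>r! \<Im>\<^bsub>0,r\<^esub>\<close> is an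
  antidifference of the falling factorial of \<open>-1 - X\<close>.
\<close>
lemma sigma_elt_commutator:
  "sigma_elt \<iota> a (i1, j1) (sigma_elt \<iota> b (i2, j2) w) - sigma_elt \<iota> b (i2, j2) (sigma_elt \<iota> a (i1, j1) w) =
    (\<Sum>k\<le>j1. sM (of_nat (j1 choose k) * ffact (of_int i2) k)
      (sigma_elt \<iota> (a * b) (i1 + i2 - int k, j1 + j2 - k) w))
    - (\<Sum>k\<le>j2. sM (of_nat (j2 choose k) * ffact (of_int i1) k)
      (sigma_elt \<iota> (b * a) (i2 + i1 - int k, j2 + j1 - k) w))
    + sM ((-1) ^ j1 * (if i1 + i2 = int j1 + int j2 then 1 else 0)
        * fact j1 * fact j2 * (of_int i1 gchoose (j1 + j2 + 1)) * tr (a * b)) (\<rho> (central 1) w)"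
proof -
  define N1 where "N1 = i1 - int j1"
  define N2 where "N2 = i2 - int j2"
  define N where "N = N1 + N2"
  let ?F = "\<lambda>r N x. ffact (x - of_int N + \<iota> - 1/2) r"
  let ?C = "\<lambda>r. fact r * Im_const \<iota> 0 r"
  let ?\<nu> = "\<lambda>k. of_nat (j1 choose k) * ffact (of_int i2) k"
  let ?\<mu> = "\<lambda>k. of_nat (j2 choose k) * ffact (of_int i1) k"
  have e1: "i1 + i2 - int k - int (j1 + j2 - k) = N" if "k \<in> {..j1}" for k
    using that by (simp add: N_def N1_def N2_def)
  have e2: "i2 + i1 - int k - int (j2 + j1 - k) = N" if "k \<in> {..j2}" for k
    using that by (simp add: N_def N1_def N2_def)
  have e3: "i1 + i2 = int j1 + int j2 \<longleftrightarrow> N = 0"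
    by (auto simp: N_def N1_def N2_def)
  have "corrected_mode (?F j1 N1) (?C j1) a N1 (corrected_mode (?F j2 N2) (?C j2) b N2 w)
      - corrected_mode (?F j2 N2) (?C j2) b N2 (corrected_mode (?F j1 N1) (?C j1) a N1 w) =
    (\<Sum>k\<le>j1. sM (?\<nu> k) (corrected_mode (?F (j1 + j2 - k) N) (?C (j1 + j2 - k)) (a * b) N w))
    - (\<Sum>k\<le>j2. sM (?\<mu> k) (corrected_mode (?F (j2 + j1 - k) N) (?C (j2 + j1 - k)) (b * a) N w))
    + (if N = 0 then sM ((-1) ^ j1 * fact j1 * fact j2 * (of_int i1 gchoose (j1 + j2 + 1))
        * tr (a * b)) (\<rho> (central 1) w) else 0)"
    unfolding N_def
  proof (rule corrected_mode_commutator_expand)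
    fix x :: complex
    let ?Z = "x - of_int (N1 + N2) + \<iota> - 1/2"
    have "x - of_int N1 + \<iota> - 1/2 = ?Z + of_int i2 - of_nat j2"
      by (simp add: N2_def)
    moreover have "x - of_int N1 - of_int N2 + \<iota> - 1/2 = ?Z"
      by simp
    ultimately show "?F j1 N1 x * ?F j2 N2 (x - of_int N1) = (\<Sum>k\<le>j1. ?\<nu> k * ?F (j1 + j2 - k) (N1 + N2) x)"
      by (simp only: ffact_product_expand)
    have 1: "x - of_int N2 + \<iota> - 1/2 = ?Z + of_int i1 - of_nat j1"
      by (simp add: N1_def)
    have 2: "x - of_int N2 - of_int N1 + \<iota> - 1/2 = ?Z"
      by simp
    have "?F j1 N1 (x - of_int N2) * ?F j2 N2 x = ?F j2 N2 x * ?F j1 N1 (x - of_int N2)"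
      by (rule mult.commute)
    also have "\<dots> = (\<Sum>k\<le>j2. ?\<mu> k * ?F (j2 + j1 - k) (N1 + N2) x)"
      unfolding 1 2 by (rule ffact_product_expand)
    finally show "?F j1 N1 (x - of_int N2) * ?F j2 N2 x =
        (\<Sum>k\<le>j2. ?\<mu> k * ?F (j2 + j1 - k) (N1 + N2) x)" .
  next
    assume "N1 + N2 = 0"
    then have N2: "N2 = - N1"
      by simp
    define G where "G X = (\<Sum>k\<le>j1. ?\<nu> k * (fact (j1 + j2 - k) * Im_const (- X) 0 (j1 + j2 - k)))" for X
    define G' where "G' X = (\<Sum>k\<le>j2. ?\<mu> k * (fact (j2 + j1 - k) * Im_const (- X) 0 (j2 + j1 - k)))" for X
    have diff: "Im_const (- (X + 1)) 0 r * fact r - Im_const (- X) 0 r * fact r = ffact (-1 - X) r" for X r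
      unfolding left_diff_distrib[symmetric] Im_const_difference by (simp add: ffact_gchoose)
    have G1: "G (X + 1) - G X = fact j1 * fact j2 * mode_product 0 j1 0 j2 N1 X" for X
    proof -
      have "G (X + 1) - G X = ffact (-1 - X + of_int i2 - of_nat j2) j1 * ffact (-1 - X) j2"
        unfolding G_def sum_subtractf[symmetric] right_diff_distrib[symmetric] mult.commute[of "fact _"]
          diff ffact_product_expand ..
      moreover have "of_int (i2 - int j2) = (of_int (- N1) :: complex)"
        using N2 by (simp only: N2_def)
      then have "-1 - X + of_int i2 - of_nat j2 = - of_int N1 - 1 - X"
        by (simp add: algebra_simps)
      ultimately show ?thesis
        by (simp add: mode_product_def ffact_gchoose)
    qed
    have G'1: "G' (X + 1) - G' X = fact j1 * fact j2 * mode_product 0 j1 0 j2 N1 (X - of_int N1)" for X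
    proof -
      have "G' (X + 1) - G' X = ffact (-1 - X + of_int i1 - of_nat j1) j2 * ffact (-1 - X) j1"
        unfolding G'_def sum_subtractf[symmetric] right_diff_distrib[symmetric] mult.commute[of "fact _"]
          diff ffact_product_expand ..
      moreover have "mode_product 0 j1 0 j2 N1 (X - of_int N1) =
          ((-1 - X) gchoose j1) * ((-1 - X + of_int i1 - of_nat j1) gchoose j2)"
        by (simp add: mode_product_def N1_def algebra_simps)
      ultimately show ?thesis
        by (simp add: ffact_gchoose)
    qed
    have "Sum_any (\<lambda>l. ?F j1 N1 (cval l) * ?F j2 N2 (cval l - of_int N1) * window N1 l) =
      G (- \<iota>) - G' (- \<iota>) + fact j1 * fact j2 * ((- of_nat 0 - 1) gchoose j1)
        * ((- of_nat j2 - 1) gchoose 0) * ((of_int N1 + of_nat 0 + of_nat j1) gchoose (0 + j1 + 0 + j2 + 1))"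
    proof (rule central_window_sum[where P = "\<lambda>x. ?F j1 N1 x * ?F j2 N2 (x - of_int N1)"])
      show "fact j1 * fact j2 \<noteq> (0 :: complex)"
        by simp
      show "?F j1 N1 x * ?F j2 N2 (x - of_int N1) =
          fact j1 * fact j2 * mode_product 0 j1 0 j2 N1 (- x - \<iota> - 1/2)" for x
        by (simp add: N2 mode_product_def ffact_gchoose algebra_simps)
      show "polyfun G" "polyfun G'"
        unfolding G_def G'_def by (intro polyfun_intros polyfun_Im_const)+
      show "G 0 = 0" "G' 0 = 0"
        unfolding G_def G'_def by (simp_all add: Im_const_zero)
    qed (rule G1 G'1)+
    moreover have "(- of_nat 0 - 1 :: complex) gchoose j1 = (-1) ^ j1"
      using choose_negated[of 0 j1] by simp
    moreover have "of_int N1 + of_nat 0 + of_nat j1 = (of_int i1 :: complex)"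
      by (simp add: N1_def)
    ultimately show "Sum_any (\<lambda>l. ?F j1 N1 (cval l) * ?F j2 N2 (cval l - of_int N1) * window N1 l) =
      (\<Sum>k\<le>j1. ?\<nu> k * ?C (j1 + j2 - k)) - (\<Sum>k\<le>j2. ?\<mu> k * ?C (j2 + j1 - k))
      + (-1) ^ j1 * fact j1 * fact j2 * (of_int i1 gchoose (j1 + j2 + 1))"
      by (simp add: G_def G'_def mult_ac)
  qed
  then show ?thesis
    unfolding sigma_elt_def case_prod_conv e3 N1_def[symmetric] N2_def[symmetric]
    by (simp only: e1 e2 cong: sum.cong) simp
qed

lemma sigma_on_elt: "sigma \<iota> (elt a p) w = sigma_elt \<iota> a p w"
  by (auto simp: sigma_def elt_def sigma_elt_linear)

lemma sigma_central: "sigma \<iota> (central c) w = sM c (\<rho> (central 1) w)"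
  by (simp add: sigma_def central_def)

lemma sigma_add_left: "sigma \<iota> (X + Y) w = sigma \<iota> X w + sigma \<iota> Y w"
proof -
  have "(\<Sum>p\<in>Poly_Mapping.keys (fst X + fst Y).
      sigma_elt \<iota> (Poly_Mapping.lookup (fst X + fst Y) p) p w) =
    (\<Sum>p\<in>Poly_Mapping.keys (fst X). sigma_elt \<iota> (Poly_Mapping.lookup (fst X) p) p w)
    + (\<Sum>p\<in>Poly_Mapping.keys (fst Y). sigma_elt \<iota> (Poly_Mapping.lookup (fst Y) p) p w)"
    by (rule setsum_keys_plus_distrib) (simp_all add: sigma_elt_linear)
  then show ?thesis
    by (simp add: sigma_def M.scale_left_distrib)
qed

lemma sigma_zero_left: "sigma \<iota> 0 w = 0"
  using sigma_add_left[of \<iota> 0 0 w] by simp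

lemma sigma_diff_left: "sigma \<iota> (X - Y) w = sigma \<iota> X w - sigma \<iota> Y w"
  using sigma_add_left[of \<iota> "X - Y" Y w] by simp

lemma sigma_sum_left: "sigma \<iota> (\<Sum>p\<in>P. X p) w = (\<Sum>p\<in>P. sigma \<iota> (X p) w)"
  by (induction P rule: infinite_finite_induct) (simp_all add: sigma_zero_left sigma_add_left)

lemma sigma_scale_left: "sigma \<iota> (cext_scale sA c X) w = sM c (sigma \<iota> X w)"
proof -
  have "(\<Sum>p\<in>Poly_Mapping.keys (fst (cext_scale sA c X)).
      sigma_elt \<iota> (Poly_Mapping.lookup (fst (cext_scale sA c X)) p) p w) =
    (\<Sum>p\<in>Poly_Mapping.keys (fst X).
      sigma_elt \<iota> (Poly_Mapping.lookup (fst (cext_scale sA c X)) p) p w)"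
    by (rule sum.mono_neutral_left)
      (auto simp: in_keys_iff cext_scale_def lookup_map_scale sigma_elt_linear)
  then show ?thesis
    by (simp add: sigma_def cext_scale_def lookup_map_scale sigma_elt_linear M.scale_sum_right
        M.scale_right_distrib)
qed

lemma sigma_linear_right:
  "sigma \<iota> X (v + w) = sigma \<iota> X v + sigma \<iota> X w"
  "sigma \<iota> X (sM c w) = sM c (sigma \<iota> X w)"
  by (simp_all add: sigma_def sigma_elt_linear rho_add rho_scale sum.distrib M.scale_right_distrib
      M.scale_sum_right M.scale_left_commute)

lemma sigma_elt_bracket:
  "sigma \<iota> (hat_bracket sA tr (elt a p) (elt b q)) w =
    sigma_elt \<iota> a p (sigma_elt \<iota> b q w) - sigma_elt \<iota> b q (sigma_elt \<iota> a p w)"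
proof -
  obtain i1 j1 i2 j2 where pq: "p = (i1, j1)" "q = (i2, j2)"
    by (metis prod.collapse)
  show ?thesis
    unfolding pq hat_bracket_elt sigma_elt_commutator
    by (simp only: sigma_add_left sigma_diff_left sigma_sum_left sigma_on_elt sigma_central
        sigma_elt_linear)
qed

lemma sigma_bracket:
  "sigma \<iota> (hat_bracket sA tr X Y) w = sigma \<iota> X (sigma \<iota> Y w) - sigma \<iota> Y (sigma \<iota> X w)"
proof -
  let ?kX = "Poly_Mapping.keys (fst X)" and ?kY = "Poly_Mapping.keys (fst Y)"
  let ?X = "Poly_Mapping.lookup (fst X)" and ?Y = "Poly_Mapping.lookup (fst Y)"
  let ?s = "sigma_elt \<iota>"
  have sum_right: "?s a p (\<Sum>i\<in>I. h i) = (\<Sum>i\<in>I. ?s a p (h i))" for a p h and I :: "(int \<times> nat) set"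
    by (induction I rule: infinite_finite_induct) (simp_all add: sigma_elt_linear)
  have "sigma \<iota> X (sigma \<iota> Y w) - sigma \<iota> Y (sigma \<iota> X w) =
    (\<Sum>p\<in>?kX. \<Sum>q\<in>?kY. ?s (?X p) p (?s (?Y q) q w)) - (\<Sum>q\<in>?kY. \<Sum>p\<in>?kX. ?s (?Y q) q (?s (?X p) p w))"
    unfolding sigma_def
    by (simp add: sigma_elt_linear sum_right sum.distrib rho_add rho_sum rho_scale
        M.scale_right_distrib M.scale_sum_right mult.commute algebra_simps)
  also have "\<dots> = (\<Sum>p\<in>?kX. \<Sum>q\<in>?kY. ?s (?X p) p (?s (?Y q) q w) - ?s (?Y q) q (?s (?X p) p w))"
    by (subst (2) sum.swap) (simp add: sum_subtractf)
  also have "\<dots> = sigma \<iota> (hat_bracket sA tr X Y) w"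
    unfolding hat_bracket_expand[of X Y] sigma_sum_left sigma_elt_bracket ..
  finally show ?thesis ..
qed

lemma sigma_lie_rep: "lie_rep (cext_scale sA) (hat_bracket sA tr) sM (sigma \<iota>)"
  unfolding lie_rep_def
proof (intro conjI allI)
  interpret C: vector_space "cext_scale sA :: complex \<Rightarrow> (int \<times> nat, 'a) cext \<Rightarrow> _"
    by (rule vector_space_cext)
  show "Vector_Spaces.linear sM sM (sigma \<iota> x)" for x
    by unfold_locales (rule sigma_linear_right)+
  show "Vector_Spaces.linear (cext_scale sA) sM (\<lambda>x. sigma \<iota> x w)" for w
    by unfold_locales (rule sigma_add_left sigma_scale_left)+
  show "sigma \<iota> (hat_bracket sA tr x y) w = sigma \<iota> x (sigma \<iota> y w) - sigma \<iota> y (sigma \<iota> x w)"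
    for x y w
    by (rule sigma_bracket)
qed

end

section \<open>Commutators of the fields and the induced representation\<close>

theorem theorem2p2:
  fixes sA :: "complex \<Rightarrow> 'a::ring_1 \<Rightarrow> 'a"
    and tr :: "'a \<Rightarrow> complex"
    and \<iota> :: complex
    and sM :: "complex \<Rightarrow> 'm::ab_group_add \<Rightarrow> 'm"
    and \<rho> :: "(halfint \<times> halfint, 'a) cext \<Rightarrow> 'm \<Rightarrow> 'm"
    and M0 :: "'m set"
  assumes "trace_algebra sA tr"
    and "vector_space sM"
    and "lie_rep (cext_scale sA) (check_bracket tr) sM \<rho>"
    and "module.subspace sM M0"
    and "lie_submodule sM \<rho> hull M0 = UNIV"
    and "\<exists>m::nat. {\<rho> x w | x w. x \<in> check_far sA m \<and> w \<in> M0} = {0}"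
  shows
    "(\<forall>a (n::int) w. finite {(i, j). hval i + hval j = of_int n \<and> \<rho> (elt a (i, j)) w \<noteq> 0}) \<and>
     (\<forall>u v w n1 n2.
        Yiota sM tr \<iota> \<rho> u n1 (Yiota sM tr \<iota> \<rho> v n2 w) - Yiota sM tr \<iota> \<rho> v n2 (Yiota sM tr \<iota> \<rho> u n1 w)
        = Res0 (series_mult sM delta_kernel (Yiota_Yplus sA sM tr \<iota> \<rho> u v w)) n1 n2) \<and>
     (\<exists>\<sigma> :: (int \<times> nat, 'a) cext \<Rightarrow> 'm \<Rightarrow> 'm.
        lie_rep (cext_scale sA) (hat_bracket sA tr) sM \<sigma> \<and>
        \<sigma> (central 1) = \<rho> (central 1) \<and>
        (\<forall>a (m::int) (r::nat) w.
           \<sigma> (elt a (m, r)) w =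
             Sum_any (\<lambda>l. sM (ffact (- cval l + \<iota> - 1/2) r)
                            (\<rho> (elt a (int_minus_half (m - int r) l, l)) w))
             + sM (fact r * (if int r = m then 1 else 0) * Im_const \<iota> 0 r * tr a)
                 (\<rho> (central 1) w)))"
proof -
  interpret trace_algebra sA tr by fact
  interpret M: vector_space sM by fact
  interpret check_rep sA tr sM \<rho>
    by unfold_locales fact
  obtain m where "{\<rho> x w | x w. x \<in> check_far sA m \<and> w \<in> M0} = {0}"
    using assms(6) by blast
  then have "\<rho> x w = 0" if "x \<in> check_far sA m" "w \<in> M0" for x w
    using that by blast
  then interpret restricted_rep sA tr sM \<rho>
    by (rule generated_imp_restricted[OF assms(5)])
  show ?thesis
  proof (intro conjI allI exI[of _ "sigma \<iota>"])
    show "sigma \<iota> (central 1) = \<rho> (central 1)"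
      by (simp add: sigma_central fun_eq_iff)
  qed (rule restricted Yiota_commutator sigma_lie_rep
      trans[OF sigma_on_elt sigma_elt_explicit])+
qed

end
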